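(* Let $h$ be a generic hyperbonode of a smooth surface. Write the surface near $h$ in Monge form $z=f(x,y)$ with $h$ at the origin, $f(0,0)=0$, $df(0,0)=0$, and with the two asymptotic lines at $h$ as the $x$- and $y$-coordinate axes. Then $$\mathrm{ind}(h)=\mathrm{sign}\left(4f_{11}^2f_{40}f_{04}-(3f_{21}^2-2f_{11}f_{31})(3f_{12}^2-2f_{11}f_{13})\right),$$ where $f_{ij}=\frac{\partial^{i+j}f}{\partial x^i\partial y^j}(0,0)$.
   Context: Setting. Surfaces lie in $\mathbb{R}\mathrm{P}^3$, and the affine chart $\{[x:y:z:1]\}$ is identified with $\mathbb{R}^3$. An asymptotic line at a point of $S$ is a tangent line having more than $2$-point contact with $S$ there. A point is hyperbolic if it has two distinct real asymptotic lines. An asymptotic curve is an integral curve of a field of asymptotic directions. Left and right. Fix an orientation of the ambient space. A regularly parametrised curve is left (right) if its first three derivatives form a negative (positive) frame. At each hyperbolic point one asymptotic curve is left and the other is right (at points where the frame degenerates the label is extended by continuity along the field of asymptotic directions). Their tangent lines are the left and right asymptotic lines $L_\ell,L_r$. The left (right) flecnodal curve $F_\ell$ (resp. $F_r$) is the set of hyperbolic points at which the left (right) asymptotic line has more than $3$-point contact with $S$. Hyperbonodes. A hyperbonode is a point of intersection of $F_\ell$ and $F_r$ (equivalently, a hyperbolic point where $S$ is approximated by a quadric up to order $3$). Cr-invariant. Let $L_{F_\ell},L_{F_r}$ be the tangent lines of $F_\ell,F_r$ at $h$. Then $\rho(h)=(L_{F_\ell},L_r,L_{F_r},L_\ell)$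 is the cross-ratio of these four lines of the tangent plane through $h$, where the cross-ratio of four lines with parameters $x_1,x_2,x_3,x_4$ is $\frac{(x_1-x_3)(x_2-x_4)}{(x_1-x_4)(x_2-x_3)}$. A hyperbonode is generic here if $F_\ell,F_r$ are smooth at $h$ and $\rho(h)\ne 0,\infty$; each asymptotic line then has exactly $4$-point contact with $S$, so locally it lies on one side of $S$. Parity and index. The parity is $\sigma(h)=+1$ if both asymptotic lines at $h$ locally lie on the same side of $S$, and $\sigma(h)=-1$ otherwise. The index of a generic hyperbonode is $\mathrm{ind}(h)=\sigma(h)\,\mathrm{sign}(\rho(h))$. *)

theory Defs
  imports "HOL-Analysis.Analysis"
begin

primrec times_differentiable_on ::
    "nat \<Rightarrow> ('a::real_normed_vector \<Rightarrow> 'b::real_normed_vector) \<Rightarrow> 'a set \<Rightarrow> bool" where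
  "times_differentiable_on 0 f U \<longleftrightarrow> continuous_on U f"
| "times_differentiable_on (Suc k) f U \<longleftrightarrow>
     (\<forall>x\<in>U. f differentiable (at x)) \<and>
     (\<forall>v. times_differentiable_on k (\<lambda>x. frechet_derivative f (at x) v) U)"

text \<open>Smoothness of class C-infinity; only used on open sets.\<close>

definition smooth_on :: "('a::real_normed_vector \<Rightarrow> 'b::real_normed_vector) \<Rightarrow> 'a set \<Rightarrow> bool" where
  "smooth_on f U \<longleftrightarrow> (\<forall>k. times_differentiable_on k f U)"

definition partial :: "(real \<Rightarrow> real \<Rightarrow> real) \<Rightarrow> nat \<Rightarrow> nat \<Rightarrow> real" where
  "partial f i j = (deriv ^^ i) (\<lambda>x. (deriv ^^ j) (f x) 0) 0"

definition curve_deriv :: "nat \<Rightarrow> (real \<Rightarrow> real^3) \<Rightarrow> real \<Rightarrow> real^3" where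
  "curve_deriv k \<gamma> = ((\<lambda>c t. vector_derivative c (at t)) ^^ k) \<gamma>"


definition local_equation ::
    "(real^3) set \<Rightarrow> real^3 \<Rightarrow> (real^3) set \<Rightarrow> (real^3 \<Rightarrow> real) \<Rightarrow> bool" where
  "local_equation S p W g \<longleftrightarrow>
     open W \<and> p \<in> W \<and> smooth_on g W \<and> S \<inter> W = {q \<in> W. g q = 0} \<and>
     (\<forall>q \<in> S \<inter> W. \<exists>v. frechet_derivative g (at q) v \<noteq> 0)"

definition smooth_surface :: "(real^3) set \<Rightarrow> bool" where
  "smooth_surface S \<longleftrightarrow> (\<forall>p\<in>S. \<exists>W g. local_equation S p W g)"


text \<open>Throughout, a line through a point \<open>p\<close> is represented by its direction, the
  one-dimensional subspace \<open>span {v}\<close>; the line itself is \<open>{p + t *\<^sub>R v | t. True}\<close>.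
  It has at least \<open>k\<close>-point contact with the surface at \<open>p\<close> if a local equation
  restricted to the line vanishes at \<open>p\<close> with multiplicity at least \<open>k\<close>;
  this does not depend on the local equation. Thus more than \<open>k\<close>-point contact is
  \<open>contact_at_least S p L (k + 1)\<close>, and contact at least 2 is tangency.\<close>

definition contact_at_least :: "(real^3) set \<Rightarrow> real^3 \<Rightarrow> (real^3) set \<Rightarrow> nat \<Rightarrow> bool" where
  "contact_at_least S p L k \<longleftrightarrow>
     (\<exists>v W g. v \<noteq> 0 \<and> L = span {v} \<and> local_equation S p W g \<and>
        (\<forall>j<k. (deriv ^^ j) (\<lambda>t. g (p + t *\<^sub>R v)) 0 = 0))"

definition asymptotic_line :: "(real^3) set \<Rightarrow> real^3 \<Rightarrow> (real^3) set \<Rightarrow> bool" where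
  "asymptotic_line S p L \<longleftrightarrow> contact_at_least S p L 3"

definition hyperbolic_point :: "(real^3) set \<Rightarrow> real^3 \<Rightarrow> bool" where
  "hyperbolic_point S p \<longleftrightarrow> p \<in> S \<and> card {L. asymptotic_line S p L} = 2"

definition asymptotic_field ::
    "(real^3) set \<Rightarrow> (real^3) set \<Rightarrow> (real^3 \<Rightarrow> real^3) \<Rightarrow> bool" where
  "asymptotic_field S U X \<longleftrightarrow>
     continuous_on U X \<and>
     (\<forall>q\<in>U. hyperbolic_point S q \<and> X q \<noteq> 0 \<and> asymptotic_line S q (span {X q}))"

text \<open>An integral curve of the direction field spanned by \<open>X\<close>, with an arbitrary regular
  parametrisation, passing through \<open>q\<close> at time 0.\<close>

definition asymptotic_curve ::
    "(real^3) set \<Rightarrow> (real^3 \<Rightarrow> real^3) \<Rightarrow> real^3 \<Rightarrow> (real \<Rightarrow> real^3) \<Rightarrow> bool" where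
  "asymptotic_curve U X q \<gamma> \<longleftrightarrow> \<gamma> 0 = q \<and>
     (\<exists>\<epsilon>>0. smooth_on \<gamma> {-\<epsilon><..<\<epsilon>} \<and>
        (\<forall>t\<in>{-\<epsilon><..<\<epsilon>}. \<gamma> t \<in> U \<and> curve_deriv 1 \<gamma> t \<noteq> 0 \<and>
           curve_deriv 1 \<gamma> t \<in> span {X (\<gamma> t)}))"

text \<open>The parameter \<open>s\<close> (\<open>1\<close> or \<open>-1\<close>) is a handedness relative to the standard orientation of
  \<open>\<real>\<^sup>3\<close>: the frame of the first three derivatives has determinant of sign \<open>s\<close>.\<close>

definition handed_curve_at :: "real \<Rightarrow> (real \<Rightarrow> real^3) \<Rightarrow> real \<Rightarrow> bool" where
  "handed_curve_at s \<gamma> t \<longleftrightarrow>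
     s * det (vector [curve_deriv 1 \<gamma> t, curve_deriv 2 \<gamma> t, curve_deriv 3 \<gamma> t] :: real^3^3) > 0"

text \<open>The label is extended by continuity along a field of asymptotic directions:
  \<open>L\<close> carries the handedness \<open>s\<close> at \<open>p\<close> if it belongs to a continuous field of asymptotic
  directions on a connected open piece \<open>U\<close> of the hyperbolic domain, one of whose integral
  curves has a frame of sign \<open>s\<close> at some point of \<open>U\<close>. All nondegenerate frames of such a
  field have the same sign, so no line gets both labels. Taking \<open>q = p\<close> gives the
  nondegenerate case.\<close>

definition handed_asymptotic_line ::
    "real \<Rightarrow> (real^3) set \<Rightarrow> real^3 \<Rightarrow> (real^3) set \<Rightarrow> bool" where
  "handed_asymptotic_line s S p L \<longleftrightarrow>
     (\<exists>U X q \<gamma>. openin (top_of_set S) U \<and> connected U \<and> p \<in> U \<and> q \<in> U \<and>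
        asymptotic_field S U X \<and> L = span {X p} \<and>
        asymptotic_curve U X q \<gamma> \<and> handed_curve_at s \<gamma> 0)"

definition handed_flecnodal_curve :: "real \<Rightarrow> (real^3) set \<Rightarrow> (real^3) set" where
  "handed_flecnodal_curve s S =
     {p. hyperbolic_point S p \<and> (\<exists>L. handed_asymptotic_line s S p L \<and> contact_at_least S p L 4)}"

text \<open>The orientation of the ambient space is \<open>\<omega> = 1\<close> (the standard one) or \<open>\<omega> = -1\<close>.
  Left means negative, right means positive with respect to it.\<close>

definition left_asymptotic_line :: "real \<Rightarrow> (real^3) set \<Rightarrow> real^3 \<Rightarrow> (real^3) set" where
  "left_asymptotic_line \<omega> S p = (THE L. handed_asymptotic_line (-\<omega>) S p L)"

definition right_asymptotic_line :: "real \<Rightarrow> (real^3) set \<Rightarrow> real^3 \<Rightarrow> (real^3) set" where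
  "right_asymptotic_line \<omega> S p = (THE L. handed_asymptotic_line \<omega> S p L)"

definition left_flecnodal_curve :: "real \<Rightarrow> (real^3) set \<Rightarrow> (real^3) set" where
  "left_flecnodal_curve \<omega> S = handed_flecnodal_curve (-\<omega>) S"

definition right_flecnodal_curve :: "real \<Rightarrow> (real^3) set \<Rightarrow> (real^3) set" where
  "right_flecnodal_curve \<omega> S = handed_flecnodal_curve \<omega> S"

definition hyperbonode :: "real \<Rightarrow> (real^3) set \<Rightarrow> real^3 \<Rightarrow> bool" where
  "hyperbonode \<omega> S h \<longleftrightarrow> h \<in> left_flecnodal_curve \<omega> S \<inter> right_flecnodal_curve \<omega> S"


text \<open>\<open>F\<close> is, near \<open>h\<close>, a smooth embedded curve with tangent line \<open>L\<close> at \<open>h\<close>.\<close>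

definition curve_tangent :: "(real^3) set \<Rightarrow> real^3 \<Rightarrow> (real^3) set \<Rightarrow> bool" where
  "curve_tangent F h L \<longleftrightarrow>
     (\<exists>W \<epsilon> \<gamma> \<kappa>. open W \<and> \<epsilon> > 0 \<and> smooth_on \<gamma> {-\<epsilon><..<\<epsilon>} \<and>
        (\<forall>t\<in>{-\<epsilon><..<\<epsilon>}. curve_deriv 1 \<gamma> t \<noteq> 0) \<and>
        homeomorphism {-\<epsilon><..<\<epsilon>} (F \<inter> W) \<gamma> \<kappa> \<and>
        \<gamma> 0 = h \<and> L = span {curve_deriv 1 \<gamma> 0})"

definition smooth_curve_at :: "(real^3) set \<Rightarrow> real^3 \<Rightarrow> bool" where
  "smooth_curve_at F h \<longleftrightarrow> (\<exists>L. curve_tangent F h L)"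

definition tangent_line :: "(real^3) set \<Rightarrow> real^3 \<Rightarrow> (real^3) set" where
  "tangent_line F h = (THE L. curve_tangent F h L)"

text \<open>The parameters \<open>x1, \<dots>, x4\<close> are taken in a basis \<open>a, b\<close> of a plane in which all four
  lines are of the form \<open>span {a + x *\<^sub>R b}\<close>; the value does not depend on the basis. No real
  value exists if the cross-ratio is infinite or indeterminate.\<close>

definition has_cross_ratio ::
    "(real^3) set \<Rightarrow> (real^3) set \<Rightarrow> (real^3) set \<Rightarrow> (real^3) set \<Rightarrow> real \<Rightarrow> bool" where
  "has_cross_ratio L1 L2 L3 L4 r \<longleftrightarrow>
     (\<exists>a b x1 x2 x3 x4. a \<noteq> b \<and> independent {a, b} \<and>
        L1 = span {a + x1 *\<^sub>R b} \<and> L2 = span {a + x2 *\<^sub>R b} \<and>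
        L3 = span {a + x3 *\<^sub>R b} \<and> L4 = span {a + x4 *\<^sub>R b} \<and>
        x1 \<noteq> x4 \<and> x2 \<noteq> x3 \<and>
        r = ((x1 - x3) * (x2 - x4)) / ((x1 - x4) * (x2 - x3)))"

definition has_cr_invariant :: "real \<Rightarrow> (real^3) set \<Rightarrow> real^3 \<Rightarrow> real \<Rightarrow> bool" where
  "has_cr_invariant \<omega> S h r \<longleftrightarrow>
     has_cross_ratio
       (tangent_line (left_flecnodal_curve \<omega> S) h) (right_asymptotic_line \<omega> S h)
       (tangent_line (right_flecnodal_curve \<omega> S) h) (left_asymptotic_line \<omega> S h) r"

definition cr_invariant :: "real \<Rightarrow> (real^3) set \<Rightarrow> real^3 \<Rightarrow> real" where
  "cr_invariant \<omega> S h = (THE r. has_cr_invariant \<omega> S h r)"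

text \<open>The requirement of exactly 4-point contact expresses that the flecnodal curves are
  nonsingular as zero loci, not merely as point sets: if a flecnodal curve has a defining
  function with nonvanishing differential and is not tangent to its own asymptotic line, the
  contact is exactly 4, whereas a multiple flecnodal curve (such as \<open>x = 0\<close> for
  \<open>z = x * y + x ^ 6\<close>) may be smooth as a set with higher contact.\<close>

definition generic_hyperbonode :: "real \<Rightarrow> (real^3) set \<Rightarrow> real^3 \<Rightarrow> bool" where
  "generic_hyperbonode \<omega> S h \<longleftrightarrow>
     hyperbonode \<omega> S h \<and>
     smooth_curve_at (left_flecnodal_curve \<omega> S) h \<and>
     smooth_curve_at (right_flecnodal_curve \<omega> S) h \<and>
     (\<forall>L. asymptotic_line S h L \<longrightarrow> contact_at_least S h L 4 \<and> \<not> contact_at_least S h L 5) \<and>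
     (\<exists>r. has_cr_invariant \<omega> S h r \<and> r \<noteq> 0)"

text \<open>Since the negative of a local equation is again a local equation, it suffices to ask
  for positive values.\<close>

definition same_side :: "(real^3) set \<Rightarrow> real^3 \<Rightarrow> (real^3) set \<Rightarrow> (real^3) set \<Rightarrow> bool" where
  "same_side S p L M \<longleftrightarrow>
     (\<exists>v w W g \<epsilon>. L = span {v} \<and> M = span {w} \<and> local_equation S p W g \<and> \<epsilon> > 0 \<and>
        (\<forall>t. 0 < \<bar>t\<bar> \<and> \<bar>t\<bar> < \<epsilon> \<longrightarrow>
           p + t *\<^sub>R v \<in> W \<and> p + t *\<^sub>R w \<in> W \<and> g (p + t *\<^sub>R v) > 0 \<and> g (p + t *\<^sub>R w) > 0))"

definition hyperbonode_parity :: "real \<Rightarrow> (real^3) set \<Rightarrow> real^3 \<Rightarrow> real" where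
  "hyperbonode_parity \<omega> S h =
     (if same_side S h (left_asymptotic_line \<omega> S h) (right_asymptotic_line \<omega> S h) then 1 else -1)"

definition hyperbonode_index :: "real \<Rightarrow> (real^3) set \<Rightarrow> real^3 \<Rightarrow> real" where
  "hyperbonode_index \<omega> S h = hyperbonode_parity \<omega> S h * sgn (cr_invariant \<omega> S h)"

text \<open>\<open>S\<close> is near \<open>h\<close> the graph \<open>z = f(x, y)\<close> in the affine coordinates with origin \<open>h\<close> and
  axes \<open>e1, e2, e3\<close>. The frame need not be orthonormal, since asymptotic lines are in general
  not perpendicular, and it need not be positively oriented.\<close>

definition monge_form ::
    "(real^3) set \<Rightarrow> real^3 \<Rightarrow> real^3 \<Rightarrow> real^3 \<Rightarrow> real^3 \<Rightarrow> (real \<Rightarrow> real \<Rightarrow> real) \<Rightarrow> bool" where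
  "monge_form S h e1 e2 e3 f \<longleftrightarrow>
     det (vector [e1, e2, e3] :: real^3^3) \<noteq> 0 \<and>
     f 0 0 = 0 \<and> ((\<lambda>(x, y). f x y) has_derivative (\<lambda>_. 0)) (at (0, 0)) \<and>
     (\<exists>W V. open W \<and> h \<in> W \<and> open V \<and> (0, 0) \<in> V \<and> smooth_on (\<lambda>(x, y). f x y) V \<and>
        S \<inter> W = (\<lambda>(x, y). h + x *\<^sub>R e1 + y *\<^sub>R e2 + f x y *\<^sub>R e3) ` V)"

end

theory Submission
  imports Defs
begin

text \<open>Two local equations of a surface have a nonzero limit ratio at every point of the surface.
  Hence contact orders do not depend on the local equation, and neither does the sign of the second
  fundamental form on the pair consisting of an asymptotic vector \<open>v\<close> and \<open>\<nabla>g \<times> v\<close>. Differentiating along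
  an asymptotic curve shows that this sign is minus the handedness of the curve; it vanishes at no
  hyperbolic point, so it is constant along a connected field of asymptotic directions. This makes left
  and right lines well defined, and shows that near \<open>h\<close> a flecnodal curve consists of points where the
  asymptotic direction close to a fixed axis annihilates the third derivative of \<open>f\<close>.

  If \<open>m\<close> is the slope of that direction for the \<open>x\<close>-axis, then \<open>f\<^sub>2\<^sub>0 + 2 f\<^sub>1\<^sub>1 m + f\<^sub>0\<^sub>2 m\<^sup>2 = 0\<close> and
  \<open>f\<^sub>3\<^sub>0 + 3 f\<^sub>2\<^sub>1 m + 3 f\<^sub>1\<^sub>2 m\<^sup>2 + f\<^sub>0\<^sub>3 m\<^sup>3 = 0\<close> along the curve. To first order at \<open>h\<close> this gives the tangent
  direction \<open>(P, A)\<close> with \<open>P = 3 f\<^sub>2\<^sub>1\<^sup>2 - 2 f\<^sub>1\<^sub>1 f\<^sub>3\<^sub>1\<close> and \<open>A = 2 f\<^sub>1\<^sub>1 f\<^sub>4\<^sub>0\<close>; symmetrically the other curve has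
  direction \<open>(B, Q)\<close>. The cross-ratio is therefore \<open>(A B - P Q) / (A B)\<close>, while the parity is the sign of
  \<open>f\<^sub>4\<^sub>0 f\<^sub>0\<^sub>4\<close>, that is, of \<open>A B\<close>.\<close>

section \<open>Directional derivatives of smooth functions\<close>

text \<open>The quotient of two local equations is recorded only by its value at one point, in the
  form g' = (c + o(1)) g. Comparing leading Taylor coefficients along lines then transfers
  derivatives up to the first nonvanishing order in each direction, which is what contact orders and
  signs are made of. Iterated directional derivatives keep all of this one-dimensional. The main
  obstacle is that a flecnodal curve is given as a point set: each of its points comes with some
  asymptotic line of the right handedness, a priori unrelated to the line at h. The selection is
  done by \<open>twist\<close>, whose signs on the two axes at h are opposite. Near h the quadratic
  equation forces any asymptotic direction of slope above 1 in modulus to be close to the second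
  axis, where \<open>twist\<close> has the wrong sign. What remains has slope at most 1 in modulus,
  chosen separately at each parameter; the same quadratic equation then yields the limit of slope
  divided by parameter.\<close>

definition dir_deriv :: "'a \<Rightarrow> ('a::real_normed_vector \<Rightarrow> 'b::real_normed_vector) \<Rightarrow> 'a \<Rightarrow> 'b" where
  "dir_deriv v g = (\<lambda>x. frechet_derivative g (at x) v)"

lemma smooth_onD:
  assumes "smooth_on g U"
  shows smooth_on_differentiable: "x \<in> U \<Longrightarrow> g differentiable (at x)"
    and smooth_on_dir_deriv: "smooth_on (dir_deriv v g) U"
    and smooth_on_continuous: "continuous_on U g"
proof -
  have s: "times_differentiable_on (Suc k) g U" for k
    using assms unfolding smooth_on_def by blast
  show "x \<in> U \<Longrightarrow> g differentiable (at x)" using s[of 0] by simp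
  show "smooth_on (dir_deriv v g) U" using s unfolding smooth_on_def dir_deriv_def by simp
  show "continuous_on U g" using assms unfolding smooth_on_def
    by (metis times_differentiable_on.simps(1))
qed

lemma smooth_on_dir_deriv_pow: "smooth_on g U \<Longrightarrow> smooth_on ((dir_deriv v ^^ j) g) U"
  by (induction j) (auto intro: smooth_on_dir_deriv)

lemma has_derivative_dir_deriv:
  "smooth_on g U \<Longrightarrow> x \<in> U \<Longrightarrow> (g has_derivative (\<lambda>v. dir_deriv v g x)) (at x)"
  unfolding dir_deriv_def using smooth_on_differentiable frechet_derivative_works by (metis eta_contract_eq)

lemma dir_deriv_eqI: "(g has_derivative g') (at x) \<Longrightarrow> dir_deriv v g x = g' v"
  unfolding dir_deriv_def using frechet_derivative_at by metis

lemma linear_dir_deriv: "smooth_on g U \<Longrightarrow> x \<in> U \<Longrightarrow> linear (\<lambda>v. dir_deriv v g x)"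
  using has_derivative_dir_deriv has_derivative_linear by blast

lemma dir_deriv_lincomb:
  assumes "smooth_on g U" "x \<in> U"
  shows "dir_deriv (a *\<^sub>R v + b *\<^sub>R w) g x = a *\<^sub>R dir_deriv v g x + b *\<^sub>R dir_deriv w g x"
  using linear_add[OF linear_dir_deriv[OF assms]] linear_scale[OF linear_dir_deriv[OF assms]] by simp

lemma dir_deriv_cong_open:
  assumes "open U" "x \<in> U" "\<And>y. y \<in> U \<Longrightarrow> f y = g y"
  shows "dir_deriv v f x = dir_deriv v g x"
proof -
  \<comment> \<open>Both functions have the same derivatives at x, so the Hilbert choice in
    \<open>frechet_derivative\<close> picks the same value, also where neither is
    differentiable.\<close>
  have "(f has_derivative f') (at x) \<longleftrightarrow> (g has_derivative f') (at x)" for f'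
    using assms has_derivative_transform_within_open by metis
  then show ?thesis unfolding dir_deriv_def frechet_derivative_def by simp
qed

lemma times_differentiable_on_cong:
  assumes "open U" "times_differentiable_on k f U" "\<And>x. x \<in> U \<Longrightarrow> f x = g x"
  shows "times_differentiable_on k g U"
  using assms
proof (induction k arbitrary: f g)
  case 0
  then show ?case by (metis continuous_on_cong times_differentiable_on.simps(1))
next
  case (Suc k)
  have "g differentiable (at x)" if "x \<in> U" for x
  proof -
    have "f differentiable (at x)" using Suc.prems that by simp
    then obtain f' where "(f has_derivative f') (at x)" unfolding differentiable_def by blast
    then have "(g has_derivative f') (at x)"
      using has_derivative_transform_within_open Suc.prems(1,3) that by metis
    then show ?thesis unfolding differentiable_def by blast
  qed
  moreover have "times_differentiable_on k (\<lambda>x. frechet_derivative g (at x) v) U" for v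
  proof (rule Suc.IH[OF Suc.prems(1)])
    show "times_differentiable_on k (\<lambda>x. frechet_derivative f (at x) v) U"
      using Suc.prems by simp
    show "frechet_derivative f (at x) v = frechet_derivative g (at x) v" if "x \<in> U" for x
      using dir_deriv_cong_open[OF Suc.prems(1) that Suc.prems(3), where v=v] unfolding dir_deriv_def by simp
  qed
  ultimately show ?case by simp
qed

lemma smooth_on_cong:
  "open U \<Longrightarrow> smooth_on f U \<Longrightarrow> (\<And>x. x \<in> U \<Longrightarrow> f x = g x) \<Longrightarrow> smooth_on g U"
  unfolding smooth_on_def using times_differentiable_on_cong by blast

lemma times_differentiable_on_subset:
  "times_differentiable_on k f U \<Longrightarrow> V \<subseteq> U \<Longrightarrow> times_differentiable_on k f V"
  by (induction k arbitrary: f) (auto intro: continuous_on_subset)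

lemma smooth_on_subset: "smooth_on f U \<Longrightarrow> V \<subseteq> U \<Longrightarrow> smooth_on f V"
  unfolding smooth_on_def using times_differentiable_on_subset by blast

lemma smooth_on_const: "smooth_on (\<lambda>x. c) U"
proof -
  have "times_differentiable_on k (\<lambda>x. c) U" for k and c :: 'b
    by (induction k arbitrary: c) auto
  then show ?thesis unfolding smooth_on_def by blast
qed

lemma smooth_on_linear:
  assumes "bounded_linear L"
  shows "smooth_on L U"
proof -
  have d: "frechet_derivative L (at x) = L" for x
    using frechet_derivative_at[OF bounded_linear_imp_has_derivative[OF assms]] by metis
  have "times_differentiable_on k L U" for k
  proof (cases k)
    case 0
    then show ?thesis using assms by (simp add: linear_continuous_on)
  next
    case (Suc m)
    then show ?thesis
      using smooth_on_const[unfolded smooth_on_def] assms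
      by (auto simp: d bounded_linear_imp_differentiable)
  qed
  then show ?thesis unfolding smooth_on_def by blast
qed

lemma dir_deriv_diff:
  assumes "f differentiable (at x)" "g differentiable (at x)"
  shows "dir_deriv v (\<lambda>x. f x - g x) x = dir_deriv v f x - dir_deriv v g x"
  by (rule dir_deriv_eqI) (use assms in \<open>auto simp: dir_deriv_def frechet_derivative_works intro!: has_derivative_diff\<close>)

lemma smooth_on_diff:
  assumes "open U" "smooth_on f U" "smooth_on g U"
  shows "smooth_on (\<lambda>x. f x - g x) U"
proof -
  have "times_differentiable_on k (\<lambda>x. f x - g x) U"
    if "smooth_on f U" "smooth_on g U" for k f g
    using that
  proof (induction k arbitrary: f g)
    case 0
    then show ?case by (auto intro: continuous_on_diff smooth_on_continuous)
  next
    case (Suc k)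
    have "times_differentiable_on k (dir_deriv v (\<lambda>x. f x - g x)) U" for v
      by (rule times_differentiable_on_cong[OF assms(1) Suc.IH[of "dir_deriv v f" "dir_deriv v g"]])
        (use Suc.prems in \<open>auto intro: smooth_on_dir_deriv simp: dir_deriv_diff smooth_on_differentiable\<close>)
    moreover have "(\<lambda>x. f x - g x) differentiable (at x)" if "x \<in> U" for x
      using differentiable_diff smooth_on_differentiable Suc.prems that by blast
    ultimately show ?case unfolding dir_deriv_def by simp
  qed
  then show ?thesis using assms unfolding smooth_on_def by blast
qed

lemma smooth_on_uminus: "open U \<Longrightarrow> smooth_on f U \<Longrightarrow> smooth_on (\<lambda>x. - f x) U"
  using smooth_on_diff[of U "\<lambda>x. 0" f] smooth_on_const by auto

text \<open>Affine maps cover both substitutions used later: chart coordinates recentred at h, and,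
  with c = 0, the exchange of x and y.\<close>

lemma has_derivative_compose_affine:
  assumes "bounded_linear T" "f differentiable (at (T x + c))"
  shows "((\<lambda>x. f (T x + c)) has_derivative (\<lambda>v. dir_deriv (T v) f (T x + c))) (at x)"
proof -
  have "((\<lambda>x. T x + c) has_derivative T) (at x)"
    using bounded_linear_imp_has_derivative[OF assms(1)] by (auto intro!: derivative_eq_intros)
  from has_derivative_compose[OF this] show ?thesis
    using assms(2) unfolding frechet_derivative_works dir_deriv_def by blast
qed

lemmas dir_deriv_compose_affine = dir_deriv_eqI[OF has_derivative_compose_affine]

lemma smooth_on_compose_affine:
  assumes T: "bounded_linear T" and "open U" "\<And>x. x \<in> U \<Longrightarrow> T x + c \<in> V" "smooth_on f V"
  shows "smooth_on (\<lambda>x. f (T x + c)) U"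
proof -
  have "times_differentiable_on k (\<lambda>x. f (T x + c)) U" if "smooth_on f V" for k f
    using that
  proof (induction k arbitrary: f)
    case 0
    have "continuous_on U (\<lambda>x. T x + c)"
      by (intro continuous_intros linear_continuous_on[OF T])
    then show ?case
      using continuous_on_compose2[OF smooth_on_continuous[OF 0]] assms(3) by auto
  next
    case (Suc k)
    have df: "f differentiable (at (T x + c))" if "x \<in> U" for x
      using Suc.prems smooth_on_differentiable assms(3) that by blast
    have "times_differentiable_on k (dir_deriv v (\<lambda>x. f (T x + c))) U" for v
      by (rule times_differentiable_on_cong[OF assms(2) Suc.IH[of "dir_deriv (T v) f"]])
        (use Suc.prems df in \<open>auto intro: smooth_on_dir_deriv simp: dir_deriv_compose_affine[OF T]\<close>)
    moreover have "(\<lambda>x. f (T x + c)) differentiable (at x)" if "x \<in> U" for x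
      using has_derivative_compose_affine[OF T df[OF that]] unfolding differentiable_def by blast
    ultimately show ?case unfolding dir_deriv_def by auto
  qed
  then show ?thesis using assms unfolding smooth_on_def by blast
qed

lemma dir_deriv_pow_compose_affine:
  assumes T: "bounded_linear T" and "open U" "\<And>x. x \<in> U \<Longrightarrow> T x + c \<in> V" "smooth_on f V"
    and "x \<in> U"
  shows "(dir_deriv v ^^ k) (\<lambda>x. f (T x + c)) x = (dir_deriv (T v) ^^ k) f (T x + c)"
  using assms(5)
proof (induction k arbitrary: x)
  case (Suc k)
  have "(dir_deriv v ^^ Suc k) (\<lambda>x. f (T x + c)) x = dir_deriv v (\<lambda>x. (dir_deriv (T v) ^^ k) f (T x + c)) x"
    using dir_deriv_cong_open[OF assms(2) Suc.prems Suc.IH] by simp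
  also have "\<dots> = dir_deriv (T v) ((dir_deriv (T v) ^^ k) f) (T x + c)"
    by (rule dir_deriv_compose_affine[OF T])
      (use smooth_on_differentiable[OF smooth_on_dir_deriv_pow[OF assms(4)]] assms(3) Suc.prems in blast)
  finally show ?case by simp
qed simp

section \<open>Restriction to lines\<close>

lemma dir_deriv_line:
  fixes x v :: "'a::real_normed_vector"
  assumes "smooth_on g U" "x + t *\<^sub>R v \<in> U"
  shows "((\<lambda>t. g (x + t *\<^sub>R v)) has_vector_derivative dir_deriv v g (x + t *\<^sub>R v)) (at t)"
proof -
  have "((\<lambda>t. x + t *\<^sub>R v) has_derivative (\<lambda>h. h *\<^sub>R v)) (at t)"
    by (auto intro!: derivative_eq_intros)
  from has_derivative_compose[OF this has_derivative_dir_deriv[OF assms]]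
  show ?thesis unfolding has_vector_derivative_def
    using linear_scale[OF linear_dir_deriv[OF assms]] by simp
qed

lemma dir_deriv_line_real:
  fixes g :: "'a::real_normed_vector \<Rightarrow> real"
  assumes "smooth_on g U" "x + t *\<^sub>R v \<in> U"
  shows "((\<lambda>t. g (x + t *\<^sub>R v)) has_real_derivative dir_deriv v g (x + t *\<^sub>R v)) (at t)"
  using dir_deriv_line[OF assms] by (simp add: has_real_derivative_iff_has_vector_derivative)

lemma open_line: "open U \<Longrightarrow> open {t. x + t *\<^sub>R v \<in> (U :: 'a::real_normed_vector set)}"
  using open_vimage[of U "\<lambda>t. x + t *\<^sub>R v"] by (simp add: vimage_def continuous_intros)

text \<open>Bridge from the iterated one-variable derivatives in the definitions of contact and
  \<open>partial\<close> to iterated directional derivatives. The parameter t stays general because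
  each \<open>deriv\<close> depends on neighbouring values.\<close>

lemma deriv_pow_line:
  fixes g :: "'a::real_normed_vector \<Rightarrow> real"
  assumes "open U" "smooth_on g U" "x + t *\<^sub>R v \<in> U"
  shows "(deriv ^^ j) (\<lambda>t. g (x + t *\<^sub>R v)) t = (dir_deriv v ^^ j) g (x + t *\<^sub>R v)"
  using assms(3)
proof (induction j arbitrary: t)
  case (Suc j)
  have "\<forall>\<^sub>F s in nhds t. (deriv ^^ j) (\<lambda>t. g (x + t *\<^sub>R v)) s = (dir_deriv v ^^ j) g (x + s *\<^sub>R v)"
    using eventually_nhds_in_open[OF open_line[OF assms(1), of x v], of t] Suc
    by (auto elim: eventually_mono)
  then have "(deriv ^^ Suc j) (\<lambda>t. g (x + t *\<^sub>R v)) t = deriv (\<lambda>s. (dir_deriv v ^^ j) g (x + s *\<^sub>R v)) t"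
    by (simp add: deriv_cong_ev)
  also have "\<dots> = dir_deriv v ((dir_deriv v ^^ j) g) (x + t *\<^sub>R v)"
    by (rule DERIV_imp_deriv, rule dir_deriv_line_real[OF smooth_on_dir_deriv_pow[OF assms(2)] Suc.prems])
  finally show ?case by simp
qed simp

text \<open>The second difference over a parallelogram is, by two applications of the mean value
  theorem, a value of either mixed second derivative.\<close>

lemma second_difference:
  fixes g :: "'a::real_normed_vector \<Rightarrow> real"
  assumes "smooth_on g U" "r > 0"
    and U: "\<And>s t. 0 \<le> s \<Longrightarrow> s \<le> r \<Longrightarrow> 0 \<le> t \<Longrightarrow> t \<le> r \<Longrightarrow> x + s *\<^sub>R u + t *\<^sub>R v \<in> U"
  shows "\<exists>s t. 0 \<le> s \<and> s \<le> r \<and> 0 \<le> t \<and> t \<le> r \<and>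
    g (x + r *\<^sub>R u + r *\<^sub>R v) - g (x + r *\<^sub>R u) - g (x + r *\<^sub>R v) + g x
      = r\<^sup>2 * dir_deriv v (dir_deriv u g) (x + s *\<^sub>R u + t *\<^sub>R v)"
proof -
  define \<phi> where "\<phi> s = g ((x + r *\<^sub>R v) + s *\<^sub>R u) - g (x + s *\<^sub>R u)" for s
  have "(\<phi> has_real_derivative
      dir_deriv u g ((x + r *\<^sub>R v) + s *\<^sub>R u) - dir_deriv u g (x + s *\<^sub>R u)) (at s)" if "0 \<le> s" "s \<le> r" for s
    unfolding \<phi>_def
    by (rule DERIV_diff; rule dir_deriv_line_real[OF assms(1)])
      (use U[of s r] U[of s 0] that \<open>r > 0\<close> in \<open>auto simp: add_ac\<close>)
  from MVT2[OF assms(2) this] obtain s where s: "0 < s" "s < r"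
    "\<phi> r - \<phi> 0 = r * (dir_deriv u g ((x + r *\<^sub>R v) + s *\<^sub>R u) - dir_deriv u g (x + s *\<^sub>R u))" by auto
  have "((\<lambda>t. dir_deriv u g ((x + s *\<^sub>R u) + t *\<^sub>R v)) has_real_derivative
      dir_deriv v (dir_deriv u g) ((x + s *\<^sub>R u) + t *\<^sub>R v)) (at t)" if "0 \<le> t" "t \<le> r" for t
    by (rule dir_deriv_line_real[OF smooth_on_dir_deriv[OF assms(1)]]) (use U[of s t] that s in auto)
  from MVT2[OF assms(2) this] obtain t where t: "0 < t" "t < r"
    "dir_deriv u g (x + s *\<^sub>R u + r *\<^sub>R v) - dir_deriv u g (x + s *\<^sub>R u) = r * dir_deriv v (dir_deriv u g) (x + s *\<^sub>R u + t *\<^sub>R v)"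
    by auto
  have "\<phi> r - \<phi> 0 = r\<^sup>2 * dir_deriv v (dir_deriv u g) (x + s *\<^sub>R u + t *\<^sub>R v)"
    using s(3) t(3) by (simp add: add_ac power2_eq_square)
  then show ?thesis
    using s t by (intro exI[of _ s] exI[of _ t]) (auto simp: \<phi>_def add_ac)
qed

text \<open>The second difference is symmetric in u and v, so over every small parallelogram some
  value of one mixed derivative equals some value of the other. Continuity at x rules out different
  limits.\<close>

lemma dir_deriv_commute:
  fixes g :: "'a::real_normed_vector \<Rightarrow> real"
  assumes "open U" "smooth_on g U" "x \<in> U"
  shows "dir_deriv u (dir_deriv v g) x = dir_deriv v (dir_deriv u g) x"
proof (rule ccontr)
  assume ne: "dir_deriv u (dir_deriv v g) x \<noteq> dir_deriv v (dir_deriv u g) x"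
  \<comment> \<open>Half the gap: two values that are closer than \<open>e\<close> to the respective
    mixed derivatives at x cannot coincide.\<close>
  define e where "e = \<bar>dir_deriv u (dir_deriv v g) x - dir_deriv v (dir_deriv u g) x\<bar> / 2"
  have "e > 0" using ne e_def by simp
  have "isCont (dir_deriv u (dir_deriv v g)) x" "isCont (dir_deriv v (dir_deriv u g)) x"
    using assms by (meson continuous_on_eq_continuous_at smooth_on_continuous smooth_on_dir_deriv)+
  then obtain d1 d2 where d: "d1 > 0" "d2 > 0"
    "\<And>y. dist y x < d1 \<Longrightarrow> dist (dir_deriv u (dir_deriv v g) y) (dir_deriv u (dir_deriv v g) x) < e"
    "\<And>y. dist y x < d2 \<Longrightarrow> dist (dir_deriv v (dir_deriv u g) y) (dir_deriv v (dir_deriv u g) x) < e"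
    using \<open>e > 0\<close> unfolding continuous_at_eps_delta dist_norm by metis
  obtain d3 where d3: "d3 > 0" "ball x d3 \<subseteq> U" using assms open_contains_ball by blast
  define d where "d = min d1 (min d2 d3)"
  \<comment> \<open>The two sides of the parallelogram together are at most d/2 long; the summand 1
    keeps the denominator positive for zero vectors.\<close>
  define r where "r = d / (2 * (norm u + norm v + 1))"
  have pos: "norm u + norm v + 1 > 0" by (smt (verit) norm_ge_zero)
  have "d / (2 * m) * m = d / 2" if "m > 0" for m :: real using that by simp
  from this[OF pos] have rb: "r * (norm u + norm v + 1) = d / 2" unfolding r_def .
  have "d > 0" using d d3 d_def by simp
  then have "r > 0" using pos r_def by simp
  have near: "dist (x + s *\<^sub>R u + t *\<^sub>R v) x < d" if "0 \<le> s" "s \<le> r" "0 \<le> t" "t \<le> r" for s t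
  proof -
    have "dist (x + s *\<^sub>R u + t *\<^sub>R v) x = norm (s *\<^sub>R u + t *\<^sub>R v)"
      by (simp add: dist_norm)
    also have "\<dots> \<le> s * norm u + t * norm v"
      using that by (intro order_trans[OF norm_triangle_ineq]) simp
    also have "\<dots> \<le> r * norm u + r * norm v"
      using that by (intro add_mono mult_right_mono) auto
    also have "\<dots> \<le> r * (norm u + norm v + 1)" using \<open>r > 0\<close> by (simp add: algebra_simps)
    also have "\<dots> = d / 2" by (rule rb)
    also have "\<dots> < d" using \<open>d > 0\<close> by simp
    finally show ?thesis .
  qed
  have inU: "x + s *\<^sub>R u + t *\<^sub>R v \<in> U" if "0 \<le> s" "s \<le> r" "0 \<le> t" "t \<le> r" for s t
    using near[OF that] d3 by (auto simp: d_def dist_commute)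
  obtain s t where st: "0 \<le> s" "s \<le> r" "0 \<le> t" "t \<le> r"
    "g (x + r *\<^sub>R u + r *\<^sub>R v) - g (x + r *\<^sub>R u) - g (x + r *\<^sub>R v) + g x
      = r\<^sup>2 * dir_deriv v (dir_deriv u g) (x + s *\<^sub>R u + t *\<^sub>R v)"
    using second_difference[OF assms(2) \<open>r > 0\<close> inU] by blast
  have "x + s *\<^sub>R v + t *\<^sub>R u \<in> U" if "0 \<le> s" "s \<le> r" "0 \<le> t" "t \<le> r" for s t
    using inU[of t s] that by (simp add: add_ac)
  then obtain t' s' where st': "0 \<le> s'" "s' \<le> r" "0 \<le> t'" "t' \<le> r"
    "g (x + r *\<^sub>R v + r *\<^sub>R u) - g (x + r *\<^sub>R v) - g (x + r *\<^sub>R u) + g x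
      = r\<^sup>2 * dir_deriv u (dir_deriv v g) (x + t' *\<^sub>R v + s' *\<^sub>R u)"
    using second_difference[OF assms(2) \<open>r > 0\<close>] by blast
  have "a + p + q = a + q + p" for a p q :: 'a by (simp add: add_ac)
  then have "r\<^sup>2 * dir_deriv v (dir_deriv u g) (x + s *\<^sub>R u + t *\<^sub>R v) = r\<^sup>2 * dir_deriv u (dir_deriv v g) (x + s' *\<^sub>R u + t' *\<^sub>R v)"
    using st(5) st'(5) by (smt (verit))
  then have eq: "dir_deriv v (dir_deriv u g) (x + s *\<^sub>R u + t *\<^sub>R v) = dir_deriv u (dir_deriv v g) (x + s' *\<^sub>R u + t' *\<^sub>R v)"
    using \<open>r > 0\<close> by simp
  have "dist (dir_deriv v (dir_deriv u g) (x + s *\<^sub>R u + t *\<^sub>R v)) (dir_deriv v (dir_deriv u g) x) < e"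
    using near[OF st(1-4)] by (intro d(4)) (simp add: d_def)
  moreover have "dist (dir_deriv u (dir_deriv v g) (x + s' *\<^sub>R u + t' *\<^sub>R v)) (dir_deriv u (dir_deriv v g) x) < e"
    using near[OF st'(1-4)] by (intro d(3)) (simp add: d_def)
  ultimately show False using eq unfolding e_def dist_real_def by (smt (verit) field_sum_of_halves)
qed

lemma dir_deriv_pow_cong_open:
  assumes "open U" "x \<in> U" "\<And>y. y \<in> U \<Longrightarrow> f y = g y"
  shows "(dir_deriv v ^^ j) f x = (dir_deriv v ^^ j) g x"
  using assms(2)
proof (induction j arbitrary: x)
  case (Suc j)
  then show ?case using dir_deriv_cong_open[OF assms(1), of x "(dir_deriv v ^^ j) f" "(dir_deriv v ^^ j) g"] by simp
qed (simp add: assms(3))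

lemma dir_deriv_pow_commute1:
  fixes g :: "'a::real_normed_vector \<Rightarrow> real"
  assumes "open U" "smooth_on g U" "x \<in> U"
  shows "dir_deriv u ((dir_deriv v ^^ j) g) x = (dir_deriv v ^^ j) (dir_deriv u g) x"
  using assms(3)
proof (induction j arbitrary: x)
  case (Suc j)
  have "dir_deriv u ((dir_deriv v ^^ Suc j) g) x = dir_deriv v (dir_deriv u ((dir_deriv v ^^ j) g)) x"
    using dir_deriv_commute[OF assms(1) smooth_on_dir_deriv_pow[OF assms(2)] Suc.prems] by simp
  also have "\<dots> = dir_deriv v ((dir_deriv v ^^ j) (dir_deriv u g)) x"
    by (rule dir_deriv_cong_open[OF assms(1) Suc.prems Suc.IH])
  finally show ?case by simp
qed simp

lemma dir_deriv_pow_commute: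
  fixes g :: "'a::real_normed_vector \<Rightarrow> real"
  assumes "open U" "smooth_on g U" "x \<in> U"
  shows "(dir_deriv u ^^ i) ((dir_deriv v ^^ j) g) x = (dir_deriv v ^^ j) ((dir_deriv u ^^ i) g) x"
  using assms(3)
proof (induction i arbitrary: x)
  case (Suc i)
  have "(dir_deriv u ^^ Suc i) ((dir_deriv v ^^ j) g) x = dir_deriv u ((dir_deriv v ^^ j) ((dir_deriv u ^^ i) g)) x"
    using dir_deriv_cong_open[OF assms(1) Suc.prems Suc.IH] by simp
  also have "\<dots> = (dir_deriv v ^^ j) (dir_deriv u ((dir_deriv u ^^ i) g)) x"
    by (rule dir_deriv_pow_commute1[OF assms(1) smooth_on_dir_deriv_pow[OF assms(2)] Suc.prems])
  finally show ?case by simp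
qed simp

lemma dir_deriv_pow_scale:
  fixes g :: "'a::real_normed_vector \<Rightarrow> real"
  assumes "open U" "smooth_on g U" "x \<in> U"
  shows "(dir_deriv (c *\<^sub>R v) ^^ j) g x = c ^ j * (dir_deriv v ^^ j) g x"
  using assms(3)
proof (induction j arbitrary: x)
  case (Suc j)
  have *: "((\<lambda>y. c ^ j * (dir_deriv v ^^ j) g y) has_derivative
      (\<lambda>w. c ^ j * dir_deriv w ((dir_deriv v ^^ j) g) x)) (at x)"
    using has_derivative_dir_deriv[OF smooth_on_dir_deriv_pow[OF assms(2)] Suc.prems]
    by (intro has_derivative_mult_right)
  have "(dir_deriv (c *\<^sub>R v) ^^ Suc j) g x = dir_deriv (c *\<^sub>R v) (\<lambda>y. c ^ j * (dir_deriv v ^^ j) g y) x"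
    using dir_deriv_cong_open[OF assms(1) Suc.prems Suc.IH] by simp
  also have "\<dots> = c ^ j * dir_deriv (c *\<^sub>R v) ((dir_deriv v ^^ j) g) x"
    using dir_deriv_eqI[OF *] .
  also have "\<dots> = c ^ Suc j * (dir_deriv v ^^ Suc j) g x"
    using linear_scale[OF linear_dir_deriv[OF smooth_on_dir_deriv_pow[OF assms(2)] Suc.prems], of c v]
    by simp
  finally show ?case .
qed simp

section \<open>Quadratic and cubic forms of higher derivatives\<close>

lemma dir_deriv_pow2_lincomb:
  fixes g :: "'a::real_normed_vector \<Rightarrow> real"
  assumes "open U" "smooth_on g U" "x \<in> U"
  shows "dir_deriv (a *\<^sub>R u + b *\<^sub>R v) (dir_deriv (a *\<^sub>R u + b *\<^sub>R v) g) x =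
    a\<^sup>2 * dir_deriv u (dir_deriv u g) x + 2 * a * b * dir_deriv u (dir_deriv v g) x + b\<^sup>2 * dir_deriv v (dir_deriv v g) x"
proof -
  let ?w = "a *\<^sub>R u + b *\<^sub>R v"
  have c: "dir_deriv z (dir_deriv ?w g) x = a * dir_deriv u (dir_deriv z g) x + b * dir_deriv v (dir_deriv z g) x" for z
    using dir_deriv_commute[OF assms, of z ?w] dir_deriv_lincomb[OF smooth_on_dir_deriv[OF assms(2)] assms(3)] by simp
  have "dir_deriv ?w (dir_deriv ?w g) x = a * dir_deriv u (dir_deriv ?w g) x + b * dir_deriv v (dir_deriv ?w g) x"
    using dir_deriv_lincomb[OF smooth_on_dir_deriv[OF assms(2)] assms(3)] by simp
  then show ?thesis unfolding c using dir_deriv_commute[OF assms, of u v]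
    by (simp add: algebra_simps power2_eq_square)
qed

text \<open>The outer derivative splits by linearity. After commuting, the inner two are the
  quadratic formula for \<open>dir_deriv z g\<close>; the mixed terms are then sorted by
  symmetry.\<close>

lemma dir_deriv_pow3_lincomb:
  fixes g :: "'a::real_normed_vector \<Rightarrow> real"
  assumes "open U" "smooth_on g U" "x \<in> U"
  shows "(dir_deriv (a *\<^sub>R u + b *\<^sub>R v) ^^ 3) g x =
    a^3 * (dir_deriv u ^^ 3) g x + 3 * a\<^sup>2 * b * (dir_deriv u ^^ 2) (dir_deriv v g) x
      + 3 * a * b\<^sup>2 * dir_deriv u ((dir_deriv v ^^ 2) g) x + b^3 * (dir_deriv v ^^ 3) g x"
proof -
  let ?w = "a *\<^sub>R u + b *\<^sub>R v"
  note [simp] = numeral_2_eq_2 numeral_3_eq_3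
  have c: "dir_deriv z ((dir_deriv ?w ^^ 2) g) x = a\<^sup>2 * dir_deriv u (dir_deriv u (dir_deriv z g)) x
      + 2 * a * b * dir_deriv u (dir_deriv v (dir_deriv z g)) x + b\<^sup>2 * dir_deriv v (dir_deriv v (dir_deriv z g)) x" for z
    using dir_deriv_pow_commute1[OF assms, of z 2 ?w]
      dir_deriv_pow2_lincomb[OF assms(1) smooth_on_dir_deriv[OF assms(2)] assms(3)] by simp
  have "(dir_deriv ?w ^^ 3) g x = a * dir_deriv u ((dir_deriv ?w ^^ 2) g) x + b * dir_deriv v ((dir_deriv ?w ^^ 2) g) x"
    using dir_deriv_lincomb[OF smooth_on_dir_deriv_pow[OF assms(2)] assms(3), of a u b v 2 ?w]
    by simp
  also have "\<dots> = a * (a\<^sup>2 * dir_deriv u (dir_deriv u (dir_deriv u g)) x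
      + 2 * a * b * dir_deriv u (dir_deriv v (dir_deriv u g)) x + b\<^sup>2 * dir_deriv v (dir_deriv v (dir_deriv u g)) x)
    + b * (a\<^sup>2 * dir_deriv u (dir_deriv u (dir_deriv v g)) x
      + 2 * a * b * dir_deriv u (dir_deriv v (dir_deriv v g)) x + b\<^sup>2 * dir_deriv v (dir_deriv v (dir_deriv v g)) x)"
    unfolding c ..
  also have "dir_deriv u (dir_deriv v (dir_deriv u g)) x = dir_deriv u (dir_deriv u (dir_deriv v g)) x"
    by (rule dir_deriv_cong_open[OF assms(1,3)]) (use dir_deriv_commute[OF assms(1,2)] in blast)
  also have "dir_deriv v (dir_deriv v (dir_deriv u g)) x = dir_deriv u (dir_deriv v (dir_deriv v g)) x"
    using dir_deriv_pow_commute1[OF assms, of u 2 v] by simp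
  finally show ?thesis by (simp add: algebra_simps)
qed

section \<open>Comparison of local equations\<close>

lemma taylor_line:
  fixes g :: "'a::real_normed_vector \<Rightarrow> real"
  assumes "smooth_on g U" "\<And>s. \<bar>s\<bar> \<le> \<bar>t\<bar> \<Longrightarrow> x + s *\<^sub>R v \<in> U"
    and "\<And>j. j < k \<Longrightarrow> (dir_deriv v ^^ j) g x = 0"
  shows "\<exists>\<xi>. \<bar>\<xi>\<bar> \<le> \<bar>t\<bar> \<and> g (x + t *\<^sub>R v) = (dir_deriv v ^^ k) g (x + \<xi> *\<^sub>R v) / fact k * t ^ k"
proof -
  have "\<forall>m s. m < k \<and> \<bar>s\<bar> \<le> \<bar>t\<bar> \<longrightarrow> ((\<lambda>s. (dir_deriv v ^^ m) g (x + s *\<^sub>R v))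
      has_real_derivative (dir_deriv v ^^ Suc m) g (x + s *\<^sub>R v)) (at s)"
    using dir_deriv_line_real[OF smooth_on_dir_deriv_pow[OF assms(1)]] assms(2) by auto
  from Maclaurin_bi_le[of "\<lambda>m s. (dir_deriv v ^^ m) g (x + s *\<^sub>R v)", OF refl this]
  show ?thesis using assms(3) by simp
qed

text \<open>The Maclaurin formula of order one replaces the mean value theorem because it treats
  both signs of t at once.\<close>

lemma mvt_line:
  fixes g :: "'a::real_normed_vector \<Rightarrow> real"
  assumes "smooth_on g U" "\<And>s. \<bar>s\<bar> \<le> \<bar>t\<bar> \<Longrightarrow> x + s *\<^sub>R v \<in> U"
  shows "\<exists>\<xi>. \<bar>\<xi>\<bar> \<le> \<bar>t\<bar> \<and> g (x + t *\<^sub>R v) - g x = t * dir_deriv v g (x + \<xi> *\<^sub>R v)"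
proof -
  have "\<forall>m s. m < 1 \<and> \<bar>s\<bar> \<le> \<bar>t\<bar> \<longrightarrow> ((\<lambda>s. (dir_deriv v ^^ m) g (x + s *\<^sub>R v))
      has_real_derivative (dir_deriv v ^^ Suc m) g (x + s *\<^sub>R v)) (at s)"
    using dir_deriv_line_real[OF assms(1)] assms(2) by auto
  from Maclaurin_bi_le[of "\<lambda>m s. (dir_deriv v ^^ m) g (x + s *\<^sub>R v)", OF refl this]
  show ?thesis by (auto simp: mult.commute)
qed

lemma tendsto_line: "((\<lambda>t. x + t *\<^sub>R v) \<longlongrightarrow> (x :: 'a::real_normed_vector)) (at 0)"
  by (auto intro!: tendsto_eq_intros)

text \<open>In the Lagrange remainder of order k the intermediate point tends to x with t, and the
  k-th derivative is continuous. Vanishing orders thus become limits, in which form two equations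
  can be compared.\<close>

lemma leading_coefficient_line:
  fixes g :: "'a::real_normed_vector \<Rightarrow> real"
  assumes "open U" "smooth_on g U" "x \<in> U"
    and "\<And>j. j < k \<Longrightarrow> (dir_deriv v ^^ j) g x = 0"
  shows "((\<lambda>t. g (x + t *\<^sub>R v) / t ^ k) \<longlongrightarrow> (dir_deriv v ^^ k) g x / fact k) (at 0)"
proof (rule tendstoI)
  fix e :: real assume "e > 0"
  have "isCont ((dir_deriv v ^^ k) g) x"
    using assms by (meson continuous_on_eq_continuous_at smooth_on_continuous smooth_on_dir_deriv_pow)
  then have c: "((\<lambda>t. (dir_deriv v ^^ k) g (x + t *\<^sub>R v) / fact k) \<longlongrightarrow> (dir_deriv v ^^ k) g x / fact k) (at 0)"
    by (intro tendsto_divide tendsto_const isCont_tendsto_compose[OF _ tendsto_line]) auto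
  have "eventually (\<lambda>t. dist ((dir_deriv v ^^ k) g (x + t *\<^sub>R v) / fact k) ((dir_deriv v ^^ k) g x / fact k) < e
      \<and> x + t *\<^sub>R v \<in> U) (at 0)"
    using tendstoD[OF c \<open>e > 0\<close>] topological_tendstoD[OF tendsto_line assms(1,3)]
    by (rule eventually_conj)
  then obtain d where d: "d > 0" "\<And>t. t \<noteq> 0 \<Longrightarrow> \<bar>t\<bar> < d \<Longrightarrow>
      dist ((dir_deriv v ^^ k) g (x + t *\<^sub>R v) / fact k) ((dir_deriv v ^^ k) g x / fact k) < e
      \<and> x + t *\<^sub>R v \<in> U"
    unfolding eventually_at by (auto simp: dist_real_def)
  have "dist (g (x + t *\<^sub>R v) / t ^ k) ((dir_deriv v ^^ k) g x / fact k) < e"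
    if "t \<noteq> 0" "\<bar>t\<bar> < d" for t
  proof -
    have "x + s *\<^sub>R v \<in> U" if "\<bar>s\<bar> \<le> \<bar>t\<bar>" for s
      \<comment> \<open>The punctured neighbourhood is silent about s = 0, where the point is x
        itself.\<close>
      using d(2)[of s] \<open>\<bar>t\<bar> < d\<close> that assms(3) by (cases "s = 0") auto
    from taylor_line[OF assms(2) this assms(4)] obtain \<xi>
      where \<xi>: "\<bar>\<xi>\<bar> \<le> \<bar>t\<bar>" "g (x + t *\<^sub>R v) = (dir_deriv v ^^ k) g (x + \<xi> *\<^sub>R v) / fact k * t ^ k"
      by blast
    then show ?thesis using d(2)[of \<xi>] that \<open>e > 0\<close> by (cases "\<xi> = 0") auto
  qed
  then show "\<forall>\<^sub>F t in at 0. dist (g (x + t *\<^sub>R v) / t ^ k) ((dir_deriv v ^^ k) g x / fact k) < e"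
    unfolding eventually_at using d(1) by (auto simp: dist_real_def intro!: exI[of _ d])
qed

section \<open>Quotients of local equations\<close>

text \<open>The statement that g'/g tends to c, in multiplied form so that it makes sense on the
  zero set of g; there it forces g' to vanish near p.\<close>

definition ratio_at :: "'a::metric_space \<Rightarrow> real \<Rightarrow> ('a \<Rightarrow> real) \<Rightarrow> ('a \<Rightarrow> real) \<Rightarrow> bool" where
  "ratio_at p c g g' \<longleftrightarrow> (\<forall>\<epsilon>>0. \<forall>\<^sub>F q in nhds p. \<bar>g' q - c * g q\<bar> \<le> \<epsilon> * \<bar>g q\<bar>)"

text \<open>Up to k!, both k-th derivatives are limits of the functions divided by t^k, and these
  quotients are compared through the ratio. The induction is strong because the limit for g'
  presupposes that its own lower derivatives vanish.\<close>

lemma ratio_at_dir_deriv_pow: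
  fixes g g' :: "'a::real_normed_vector \<Rightarrow> real"
  assumes r: "ratio_at p c g g'"
    and "open U" "smooth_on g U" "p \<in> U" "open U'" "smooth_on g' U'" "p \<in> U'"
    and "\<And>j. j < k \<Longrightarrow> (dir_deriv v ^^ j) g p = 0"
  shows "(dir_deriv v ^^ k) g' p = c * (dir_deriv v ^^ k) g p"
  using assms(8)
proof (induction k rule: less_induct)
  case (less k)
  have "(dir_deriv v ^^ j) g' p = 0" if "j < k" for j
    using less.IH[OF that] less.prems that by simp
  from leading_coefficient_line[OF assms(5-7) this]
  have 1: "((\<lambda>t. g' (p + t *\<^sub>R v) / t ^ k) \<longlongrightarrow> (dir_deriv v ^^ k) g' p / fact k) (at 0)" .
  have 2: "((\<lambda>t. g (p + t *\<^sub>R v) / t ^ k) \<longlongrightarrow> (dir_deriv v ^^ k) g p / fact k) (at 0)"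
    by (rule leading_coefficient_line[OF assms(2-4) less.prems])
  define L where "L = (dir_deriv v ^^ k) g p / fact k"
  have 3: "((\<lambda>t. g' (p + t *\<^sub>R v) / t ^ k - c * (g (p + t *\<^sub>R v) / t ^ k)) \<longlongrightarrow> 0) (at 0)"
  proof (rule tendstoI)
    fix e :: real assume "e > 0"
    \<comment> \<open>The quotient by t^k is eventually below |L| + 1 in modulus; dividing by |L| +
      2 makes the final bound strict.\<close>
    define e' where "e' = e / (\<bar>L\<bar> + 2)"
    have "e' > 0" using \<open>e > 0\<close> by (simp add: e'_def)
    have "\<forall>\<^sub>F t in at 0. \<bar>g' (p + t *\<^sub>R v) - c * g (p + t *\<^sub>R v)\<bar> \<le> e' * \<bar>g (p + t *\<^sub>R v)\<bar>"
      using r \<open>e' > 0\<close> tendsto_line[of p v] unfolding ratio_at_def filterlim_iff by blast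
    moreover have "\<forall>\<^sub>F t in at 0. \<bar>g (p + t *\<^sub>R v) / t ^ k\<bar> < \<bar>L\<bar> + 1"
      using tendstoD[OF 2, of 1] unfolding L_def[symmetric]
      by (auto elim!: eventually_mono simp: dist_real_def)
    ultimately show "\<forall>\<^sub>F t in at 0.
        dist (g' (p + t *\<^sub>R v) / t ^ k - c * (g (p + t *\<^sub>R v) / t ^ k)) 0 < e"
    proof eventually_elim
      case (elim t)
      have "\<bar>g' (p + t *\<^sub>R v) / t ^ k - c * (g (p + t *\<^sub>R v) / t ^ k)\<bar>
          = \<bar>g' (p + t *\<^sub>R v) - c * g (p + t *\<^sub>R v)\<bar> / \<bar>t ^ k\<bar>"
        by (simp add: abs_divide[symmetric] diff_divide_distrib)
      also have "\<dots> \<le> e' * \<bar>g (p + t *\<^sub>R v)\<bar> / \<bar>t ^ k\<bar>"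
        using elim(1) by (intro divide_right_mono) auto
      also have "\<dots> = e' * \<bar>g (p + t *\<^sub>R v) / t ^ k\<bar>" by (simp add: abs_divide)
      also have "\<dots> \<le> e' * (\<bar>L\<bar> + 1)" using elim(2) \<open>e' > 0\<close> by (intro mult_left_mono) auto
      also have "\<dots> < e' * (\<bar>L\<bar> + 2)" using \<open>e' > 0\<close> by simp
      also have "\<dots> = e" by (simp add: e'_def)
      finally show ?case by simp
    qed
  qed
  have "((\<lambda>t. g' (p + t *\<^sub>R v) / t ^ k) \<longlongrightarrow> 0 + c * L) (at 0)"
    using tendsto_add[OF 3 tendsto_mult[OF tendsto_const[of c] 2]] by (simp add: L_def)
  from tendsto_unique[OF _ 1 this] show ?case by (simp add: L_def)
qed

lemma local_equationD:
  assumes "local_equation S p W g"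
  shows "open W" "p \<in> W" "smooth_on g W" "q \<in> W \<Longrightarrow> q \<in> S \<longleftrightarrow> g q = 0"
    and "q \<in> S \<Longrightarrow> q \<in> W \<Longrightarrow> \<exists>v. dir_deriv v g q \<noteq> 0"
    and "q \<in> W \<Longrightarrow> local_equation S q W g"
  using assms unfolding local_equation_def dir_deriv_def by auto

lemma local_equation_uminus:
  assumes "local_equation S p W g"
  shows "local_equation S p W (\<lambda>q. - g q)"
proof -
  note L = local_equationD[OF assms]
  have "dir_deriv v (\<lambda>q. - g q) q = - dir_deriv v g q" if "q \<in> W" for v q
    using dir_deriv_eqI[OF has_derivative_minus[OF has_derivative_dir_deriv[OF L(3) that]]] .
  then have "\<exists>v. dir_deriv v (\<lambda>q. - g q) q \<noteq> 0" if "q \<in> S" "q \<in> W" for q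
    using L(5)[OF that] that by auto
  then show ?thesis
    using L(2,4) smooth_on_uminus[OF L(1,3)] L(1) unfolding local_equation_def dir_deriv_def by auto
qed

text \<open>Near a point of the surface, move from an arbitrary point to the surface along a fixed
  transversal direction: both local equations are then, up to their transversal derivatives,
  equal to the distance travelled.\<close>

lemma local_equation_ratio:
  assumes "p \<in> S" and g: "local_equation S p W g" and g': "local_equation S p W' g'"
  shows "\<exists>c. c \<noteq> 0 \<and> ratio_at p c g g'"
proof -
  note L = local_equationD[OF g] and L' = local_equationD[OF g']
  obtain v0 where v0: "dir_deriv v0 g p \<noteq> 0" using L(2,5) assms(1) by blast
  \<comment> \<open>Normalised so that g measures distance along v to first order; the limit ratio
    is then the derivative of g' along v.\<close>
  define v where "v = (1 / dir_deriv v0 g p) *\<^sub>R v0"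
  have v: "dir_deriv v g p = 1"
    using linear_scale[OF linear_dir_deriv[OF L(3,2)], of "1 / dir_deriv v0 g p" v0] v0 by (simp add: v_def)
  define c where "c = dir_deriv v g' p"
  have "ratio_at p c g g'" unfolding ratio_at_def
  proof (intro allI impI)
    fix \<epsilon> :: real assume "\<epsilon> > 0"
    \<comment> \<open>The bound 1/2 keeps the derivative of g along v at least 1/2; the other one
      makes the final error 2 (1 + |c|) e at most \<epsilon>.\<close>
    define e where "e = min (1 / 2) (\<epsilon> / (2 * (1 + \<bar>c\<bar>)))"
    have "e \<le> 1 / 2" unfolding e_def by (rule min.cobounded1)
    moreover have "e > 0" using \<open>\<epsilon> > 0\<close> by (simp add: e_def)
    ultimately have e: "e > 0" "e \<le> 1 / 2" by auto
    have "e \<le> \<epsilon> / (2 * (1 + \<bar>c\<bar>))" unfolding e_def by simp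
    then have e2: "2 * ((1 + \<bar>c\<bar>) * e) \<le> \<epsilon>"
      by (subst (asm) le_divide_eq) (auto simp: algebra_simps split: if_splits)
    have "isCont (dir_deriv v g) p" "isCont (dir_deriv v g') p" "isCont g p"
      using L(1,2,3) L'(1,2,3)
      by (meson continuous_on_eq_continuous_at smooth_on_continuous smooth_on_dir_deriv)+
    then have t: "(dir_deriv v g \<longlongrightarrow> 1) (nhds p)" "(dir_deriv v g' \<longlongrightarrow> c) (nhds p)" "(g \<longlongrightarrow> g p) (nhds p)"
      unfolding isCont_def tendsto_at_iff_tendsto_nhds by (simp_all add: v c_def)
    have "\<forall>\<^sub>F q in nhds p. dist (dir_deriv v g q) 1 < e \<and> dist (dir_deriv v g' q) c < e \<and> q \<in> W \<and> q \<in> W'"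
      using tendstoD[OF t(1) e(1)] tendstoD[OF t(2) e(1)]
        eventually_nhds_in_open[OF L(1,2)] eventually_nhds_in_open[OF L'(1,2)]
      by eventually_elim auto
    then obtain r where r: "r > 0" "\<And>q. dist q p < r \<Longrightarrow>
        dist (dir_deriv v g q) 1 < e \<and> dist (dir_deriv v g' q) c < e \<and> q \<in> W \<and> q \<in> W'"
      unfolding eventually_nhds_metric by blast
    \<comment> \<open>With |g q| < b the distance travelled from q, at most 2 |g q| times the norm
      of v, is at most r/2; the other r/2 is left for the distance from q to p.\<close>
    define b where "b = r / (4 * (norm v + 1))"
    have nv: "norm v + 1 > 0" by (smt (verit) norm_ge_zero)
    have "b > 0" using r nv by (simp add: b_def)
    have "2 * (r / (4 * m)) * m = r / 2" if "m > 0" for m using that by simp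
    from this[OF nv] have rb: "2 * b * (norm v + 1) = r / 2" unfolding b_def .
    have "g p = 0" using L(2,4) assms(1) by blast
    then have "\<forall>\<^sub>F q in nhds p. \<bar>g q\<bar> < b"
      using tendstoD[OF t(3) \<open>b > 0\<close>] by (simp add: dist_real_def)
    moreover have "\<forall>\<^sub>F q in nhds p. dist q p < r / 2"
      using r(1) by (auto simp: eventually_nhds_metric intro!: exI[of _ "r / 2"])
    ultimately show "\<forall>\<^sub>F q in nhds p. \<bar>g' q - c * g q\<bar> \<le> \<epsilon> * \<bar>g q\<bar>"
    proof eventually_elim
      case (elim q)
      \<comment> \<open>At rate at least 1/2, moving by T in either direction changes g by at least
        |g q|, so a zero of g lies in between.\<close>
      define T where "T = 2 * \<bar>g q\<bar>"
      have near: "dist (q + t *\<^sub>R v) p < r" if "\<bar>t\<bar> \<le> T" for t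
      proof -
        have "\<bar>t\<bar> * norm v \<le> T * (norm v + 1)" using that by (intro mult_mono) auto
        also have "\<dots> \<le> 2 * b * (norm v + 1)"
          using elim(1) nv by (intro mult_right_mono) (auto simp: T_def)
        also have "\<dots> = r / 2" by (rule rb)
        finally have "norm (t *\<^sub>R v) \<le> r / 2" by simp
        moreover have "dist (q + t *\<^sub>R v) p \<le> dist q p + norm (t *\<^sub>R v)"
          unfolding dist_norm by (metis add_diff_eq add.commute norm_triangle_ineq)
        ultimately show ?thesis using elim(2) by linarith
      qed
      have mvt: "\<exists>\<xi>. \<bar>\<xi>\<bar> \<le> T \<and> \<phi> (q + t *\<^sub>R v) - \<phi> q = t * dir_deriv v \<phi> (q + \<xi> *\<^sub>R v)"
        if "\<bar>t\<bar> \<le> T" "\<phi> = g \<and> X = W \<or> \<phi> = g' \<and> X = W'" for t \<phi> X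
      proof -
        have "smooth_on \<phi> X" using that(2) L(3) L'(3) by auto
        moreover have "q + s *\<^sub>R v \<in> X" if "\<bar>s\<bar> \<le> \<bar>t\<bar>" for s
          using r(2)[OF near[of s]] that \<open>\<bar>t\<bar> \<le> T\<close> \<open>\<phi> = g \<and> X = W \<or> \<phi> = g' \<and> X = W'\<close> by auto
        ultimately have "\<exists>\<xi>. \<bar>\<xi>\<bar> \<le> \<bar>t\<bar> \<and> \<phi> (q + t *\<^sub>R v) - \<phi> q = t * dir_deriv v \<phi> (q + \<xi> *\<^sub>R v)"
          by (rule mvt_line)
        then show ?thesis using that(1) order_trans by blast
      qed
      have d1: "1 / 2 \<le> dir_deriv v g (q + \<xi> *\<^sub>R v)" "\<bar>dir_deriv v g (q + \<xi> *\<^sub>R v) - 1\<bar> \<le> e"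
        "\<bar>dir_deriv v g' (q + \<xi> *\<^sub>R v) - c\<bar> \<le> e" if "\<bar>\<xi>\<bar> \<le> T" for \<xi>
        using r(2)[OF near[OF that]] e by (auto simp: dist_real_def abs_less_iff abs_le_iff)
      have "T \<ge> 0" by (simp add: T_def)
      obtain \<xi>1 where x1: "\<bar>\<xi>1\<bar> \<le> T" "g (q + T *\<^sub>R v) - g q = T * dir_deriv v g (q + \<xi>1 *\<^sub>R v)"
        using mvt[of T g] \<open>T \<ge> 0\<close> by auto
      obtain \<xi>2 where x2: "\<bar>\<xi>2\<bar> \<le> T" "g (q + (-T) *\<^sub>R v) - g q = (-T) * dir_deriv v g (q + \<xi>2 *\<^sub>R v)"
        using mvt[of "-T" g W] \<open>T \<ge> 0\<close> by auto
      have "T * (1/2) \<le> T * dir_deriv v g (q + \<xi>1 *\<^sub>R v)" "T * (1/2) \<le> T * dir_deriv v g (q + \<xi>2 *\<^sub>R v)"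
        using mult_left_mono[OF d1(1)[OF x1(1)] \<open>T \<ge> 0\<close>]
          mult_left_mono[OF d1(1)[OF x2(1)] \<open>T \<ge> 0\<close>] by blast+
      then have "g (q + (-T) *\<^sub>R v) \<le> 0" "0 \<le> g (q + T *\<^sub>R v)"
        using x1(2) x2(2) unfolding T_def by (auto split: abs_split)
      moreover have "continuous_on {-T..T} (\<lambda>t. g (q + t *\<^sub>R v))"
        using r(2)[OF near]
        by (intro continuous_on_compose2[OF smooth_on_continuous[OF L(3)]] continuous_intros)
          (auto simp: abs_le_iff)
      ultimately obtain \<tau> where tau: "-T \<le> \<tau>" "\<tau> \<le> T" "g (q + \<tau> *\<^sub>R v) = 0"
        using IVT'[of "\<lambda>t. g (q + t *\<^sub>R v)" "-T" 0 T] \<open>T \<ge> 0\<close> by auto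
      then have "\<bar>\<tau>\<bar> \<le> T" by (simp add: abs_le_iff)
      \<comment> \<open>This ties the two equations together: a zero of g in W is a point of S,
        hence also a zero of g'.\<close>
      then have "g' (q + \<tau> *\<^sub>R v) = 0" using tau(3) r(2)[OF near] L(4) L'(4) by blast
      obtain \<xi> where x: "\<bar>\<xi>\<bar> \<le> T" "g (q + \<tau> *\<^sub>R v) - g q = \<tau> * dir_deriv v g (q + \<xi> *\<^sub>R v)"
        using mvt[of \<tau> g W] \<open>\<bar>\<tau>\<bar> \<le> T\<close> by auto
      obtain \<xi>' where x': "\<bar>\<xi>'\<bar> \<le> T" "g' (q + \<tau> *\<^sub>R v) - g' q = \<tau> * dir_deriv v g' (q + \<xi>' *\<^sub>R v)"
        using mvt[of \<tau> g' W'] \<open>\<bar>\<tau>\<bar> \<le> T\<close> by auto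
      \<comment> \<open>\<open>A\<close> and \<open>A'\<close> are the deviations of the transversal
        derivatives from 1 and c; in g' - c g the main terms cancel.\<close>
      define A where "A = dir_deriv v g (q + \<xi> *\<^sub>R v) - 1"
      define A' where "A' = dir_deriv v g' (q + \<xi>' *\<^sub>R v) - c"
      have "g q = - (\<tau> * (A + 1))" "g' q = - (\<tau> * (A' + c))"
        using x(2) x'(2) tau(3) \<open>g' (q + \<tau> *\<^sub>R v) = 0\<close> by (simp_all add: A_def A'_def)
      then have "g' q - c * g q = \<tau> * (c * A - A')" by algebra
      then have "\<bar>g' q - c * g q\<bar> = \<bar>\<tau>\<bar> * \<bar>c * A - A'\<bar>" by (simp add: abs_mult)
      also have "\<bar>c * A - A'\<bar> \<le> \<bar>c\<bar> * \<bar>A\<bar> + \<bar>A'\<bar>"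
        by (metis abs_mult abs_triangle_ineq4)
      also have "\<dots> \<le> \<bar>c\<bar> * e + e"
        using d1(2)[OF x(1)] d1(3)[OF x'(1)] unfolding A_def A'_def
        by (intro add_mono mult_left_mono) auto
      also have "\<dots> = (1 + \<bar>c\<bar>) * e" by (simp add: algebra_simps)
      finally have "\<bar>g' q - c * g q\<bar> \<le> \<bar>\<tau>\<bar> * ((1 + \<bar>c\<bar>) * e)"
        by (simp add: mult_left_mono)
      also have "\<dots> \<le> T * ((1 + \<bar>c\<bar>) * e)"
        using \<open>\<bar>\<tau>\<bar> \<le> T\<close> e(1) by (intro mult_right_mono) auto
      also have "\<dots> = (2 * ((1 + \<bar>c\<bar>) * e)) * \<bar>g q\<bar>" by (simp add: T_def)
      also have "\<dots> \<le> \<epsilon> * \<bar>g q\<bar>" using e2 by (intro mult_right_mono) auto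
      finally show ?case .
    qed
  qed
  \<comment> \<open>Otherwise all first derivatives of g' would vanish at p, against the regularity
    of a local equation.\<close>
  moreover have "c \<noteq> 0"
  proof
    assume "c = 0"
    obtain w where w: "dir_deriv w g' p \<noteq> 0" using L'(2,5) assms(1) by blast
    have "g p = 0" using L(2,4) assms(1) by blast
    then have "(dir_deriv w ^^ 1) g' p = c * (dir_deriv w ^^ 1) g p"
      by (intro ratio_at_dir_deriv_pow[OF \<open>ratio_at p c g g'\<close> L(1,3,2) L'(1,3,2)]) simp
    then show False using w \<open>c = 0\<close> by simp
  qed
  ultimately show ?thesis by blast
qed

section \<open>Independence of contact from the local equation\<close>

text \<open>Contact is defined with a free choice of generator and equation. Another generator
  rescales the derivatives by powers, another equation preserves vanishing up to order k by
  induction on j, so one fixed pair decides.\<close>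

lemma contact_at_least_iff:
  assumes "p \<in> S" and g: "local_equation S p W g" and "v \<noteq> 0"
  shows "contact_at_least S p (span {v}) k \<longleftrightarrow> (\<forall>j<k. (dir_deriv v ^^ j) g p = 0)"
proof
  assume "contact_at_least S p (span {v}) k"
  then obtain v' W' g' where c: "v' \<noteq> 0" "span {v} = span {v'}" "local_equation S p W' g'"
    "\<forall>j<k. (deriv ^^ j) (\<lambda>t. g' (p + t *\<^sub>R v')) 0 = 0"
    unfolding contact_at_least_def by blast
  note L = local_equationD[OF g] and L' = local_equationD[OF c(3)]
  have "v \<in> span {v'}" using c(2) by (metis insertI1 span_base)
  then obtain a where a: "v = a *\<^sub>R v'" unfolding span_singleton by auto
  have z: "(dir_deriv v' ^^ j) g' p = 0" if "j < k" for j
    using c(4) that deriv_pow_line[OF L'(1,3), of p 0 v' j] L'(2) by simp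
  then have z: "(dir_deriv v ^^ j) g' p = 0" if "j < k" for j
    using dir_deriv_pow_scale[OF L'(1,3,2)] that a by simp
  obtain d where d: "ratio_at p d g' g" using local_equation_ratio[OF assms(1) c(3) g] by blast
  show "\<forall>j<k. (dir_deriv v ^^ j) g p = 0"
  proof (intro allI impI)
    fix j assume "j < k"
    then have "(dir_deriv v ^^ j) g p = d * (dir_deriv v ^^ j) g' p"
      using z by (intro ratio_at_dir_deriv_pow[OF d L'(1,3,2) L(1,3,2)]) auto
    then show "(dir_deriv v ^^ j) g p = 0" using z \<open>j < k\<close> by simp
  qed
next
  note L = local_equationD[OF g]
  assume "\<forall>j<k. (dir_deriv v ^^ j) g p = 0"
  then show "contact_at_least S p (span {v}) k"
    unfolding contact_at_least_def using assms L(2) deriv_pow_line[OF L(1,3), of p 0 v]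
    by (intro exI[of _ v] exI[of _ W] exI[of _ g]) auto
qed

lemma asymptotic_line_iff:
  assumes "p \<in> S" and g: "local_equation S p W g" and "v \<noteq> 0"
  shows "asymptotic_line S p (span {v}) \<longleftrightarrow> dir_deriv v g p = 0 \<and> dir_deriv v (dir_deriv v g) p = 0"
proof -
  have "g p = 0" using local_equationD(2,4)[OF g] assms(1) by blast
  then show ?thesis unfolding asymptotic_line_def contact_at_least_iff[OF assms]
    by (auto simp: numeral_3_eq_3 less_Suc_eq)
qed

section \<open>Gradient and second fundamental form\<close>

definition grad :: "(real^3 \<Rightarrow> real) \<Rightarrow> real^3 \<Rightarrow> real^3" where
  "grad g x = (\<chi> i. dir_deriv (axis i 1) g x)"

lemma dir_deriv_sum:
  fixes g :: "real^3 \<Rightarrow> real"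
  assumes "smooth_on g U" "x \<in> U"
  shows "dir_deriv v g x = (\<Sum>i\<in>UNIV. v $ i * dir_deriv (axis i 1) g x)"
proof -
  have "dir_deriv v g x = dir_deriv (\<Sum>i\<in>UNIV. v $ i *\<^sub>R axis i 1) g x"
    using basis_expansion[of v] by (simp add: scalar_mult_eq_scaleR)
  also have "\<dots> = (\<Sum>i\<in>UNIV. v $ i * dir_deriv (axis i 1) g x)"
    using linear_sum[OF linear_dir_deriv[OF assms], of "\<lambda>i. v $ i *\<^sub>R axis i 1" UNIV]
      linear_scale[OF linear_dir_deriv[OF assms]] by simp
  finally show ?thesis .
qed

lemma dir_deriv_inner_grad: "smooth_on g U \<Longrightarrow> x \<in> U \<Longrightarrow> dir_deriv v g x = v \<bullet> grad g x"
  using dir_deriv_sum[of g U x v] by (simp add: grad_def inner_vec_def)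

text \<open>The coordinate form of the Hessian separates the two directions from the base point, so
  that all three can vary in limits and the directions can be scaled.\<close>

lemma dir_deriv2_sum:
  fixes g :: "real^3 \<Rightarrow> real"
  assumes "open U" "smooth_on g U" "x \<in> U"
  shows "dir_deriv v (dir_deriv w g) x = (\<Sum>i\<in>UNIV. v $ i *
    (\<Sum>j\<in>UNIV. w $ j * dir_deriv (axis j 1) (dir_deriv (axis i 1) g) x))"
proof -
  have "dir_deriv (axis i 1) (dir_deriv w g) x = (\<Sum>j\<in>UNIV. w $ j * dir_deriv (axis j 1) (dir_deriv (axis i 1) g) x)" for i
    using dir_deriv_commute[OF assms, of "axis i 1" w] dir_deriv_sum[OF smooth_on_dir_deriv[OF assms(2)] assms(3), of w]
    by metis
  then show ?thesis
    using dir_deriv_sum[OF smooth_on_dir_deriv[OF assms(2)] assms(3), of v w] by presburger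
qed

text \<open>The sign does not depend on the local equation and is opposite to the handedness of the
  asymptotic line spanned by \<open>v\<close>.\<close>

definition twist :: "(real^3 \<Rightarrow> real) \<Rightarrow> real^3 \<Rightarrow> real^3 \<Rightarrow> real" where
  "twist g x v = dir_deriv v (dir_deriv (cross3 (grad g x) v) g) x"

text \<open>In \<open>twist\<close> the direction \<open>cross3 (grad g x) v\<close> is frozen
  before differentiating. The value is therefore a polynomial in v and the first two derivatives of
  g at x, jointly continuous in x and v.\<close>

lemma tendsto_twist:
  assumes "open U" "smooth_on g U" "x0 \<in> U" "(x \<longlongrightarrow> x0) F" "(v \<longlongrightarrow> v0) F"
  shows "((\<lambda>z. twist g (x z) (v z)) \<longlongrightarrow> twist g x0 v0) F"
proof -
  have c: "((\<lambda>z. h (x z)) \<longlongrightarrow> h x0) F" if "smooth_on h U" for h :: "real^3 \<Rightarrow> real"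
    using isCont_tendsto_compose[OF _ assms(4)] smooth_on_continuous[OF that] assms(1,3)
    by (metis continuous_on_eq_continuous_at)
  have gr: "((\<lambda>z. grad g (x z)) \<longlongrightarrow> grad g x0) F"
    unfolding grad_def by (intro tendsto_vec_lambda c smooth_on_dir_deriv assms)
  have cr: "((\<lambda>z. cross3 (grad g (x z)) (v z)) \<longlongrightarrow> cross3 (grad g x0) v0) F"
  proof -
    have "continuous (at (grad g x0, v0)) (\<lambda>p. cross3 (fst p) (snd p))"
      by (intro continuous_cross continuous_fst continuous_snd continuous_ident)
    from isCont_tendsto_compose[OF this tendsto_Pair[OF gr assms(5)]] show ?thesis by simp
  qed
  let ?h = "\<lambda>y v w. (\<Sum>i\<in>UNIV. v $ i *
    (\<Sum>j\<in>UNIV. w $ j * dir_deriv (axis j 1) (dir_deriv (axis i 1) g) y))"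
  have "((\<lambda>z. ?h (x z) (v z) (cross3 (grad g (x z)) (v z))) \<longlongrightarrow>
      ?h x0 v0 (cross3 (grad g x0) v0)) F"
    by (intro tendsto_sum tendsto_mult tendsto_vec_nth cr assms(5) c smooth_on_dir_deriv assms(2))
  moreover have "\<forall>\<^sub>F z in F. twist g (x z) (v z) = ?h (x z) (v z) (cross3 (grad g (x z)) (v z))"
    using topological_tendstoD[OF assms(4,1,3)]
    by eventually_elim (unfold twist_def, rule dir_deriv2_sum[OF assms(1,2)])
  moreover have "twist g x0 v0 = ?h x0 v0 (cross3 (grad g x0) v0)"
    unfolding twist_def by (rule dir_deriv2_sum[OF assms(1-3)])
  ultimately show ?thesis by (simp only: tendsto_cong)
qed

text \<open>The vector enters as a direction and again in the cross product, so the factor is a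
  square and the sign belongs to the line, not to its generator.\<close>

lemma twist_scale:
  assumes "open U" "smooth_on g U" "x \<in> U"
  shows "twist g x (a *\<^sub>R v) = a\<^sup>2 * twist g x v"
  using dir_deriv2_sum[OF assms, of v "cross3 (grad g x) v"]
    dir_deriv2_sum[OF assms, of "a *\<^sub>R v" "cross3 (grad g x) (a *\<^sub>R v)"]
  unfolding twist_def by (simp add: cross_mult_right sum_distrib_left power2_eq_square mult_ac)

text \<open>The limit ratio transfers only pure second derivatives in tangent directions. Polarising
  over v, w and v + w gives the mixed one with factor c; the gradient inside the cross product
  contributes another c, so the factor c^2 is positive.\<close>

lemma twist_local_equation:
  assumes "p \<in> S" and g: "local_equation S p W g" and g': "local_equation S p W' g'"
    and "dir_deriv v g p = 0"
  shows "\<exists>d>0. twist g' p v = d * twist g p v"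
proof -
  note L = local_equationD[OF g] and L' = local_equationD[OF g']
  obtain c where c: "c \<noteq> 0" "ratio_at p c g g'" using local_equation_ratio[OF assms(1-3)] by blast
  note r = ratio_at_dir_deriv_pow[OF c(2) L(1,3,2) L'(1,3,2)]
  have "g p = 0" using L(2,4) assms(1) by blast
  then have d1: "dir_deriv w g' p = c * dir_deriv w g p" for w using r[of 1 w] by simp
  have d2: "dir_deriv w (dir_deriv w g') p = c * dir_deriv w (dir_deriv w g) p" if "dir_deriv w g p = 0" for w
    using r[of 2 w] that \<open>g p = 0\<close> by (fastforce simp: numeral_2_eq_2 less_Suc_eq)
  define w where "w = cross3 (grad g p) v"
  have w: "dir_deriv w g p = 0"
    using dir_deriv_inner_grad[OF L(3,2), of w] by (simp add: w_def dot_cross_self)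
  have "dir_deriv (1 *\<^sub>R v + 1 *\<^sub>R w) g p = 0"
    using dir_deriv_lincomb[OF L(3,2), of 1 v 1 w] w assms(4) by simp
  from d2[OF this] d2[OF w] d2[OF assms(4)]
  have polar: "dir_deriv v (dir_deriv w g') p = c * dir_deriv v (dir_deriv w g) p"
    unfolding dir_deriv_pow2_lincomb[OF L(1,3,2)] dir_deriv_pow2_lincomb[OF L'(1,3,2)]
    by (simp add: algebra_simps)
  have "grad g' p = c *\<^sub>R grad g p" by (simp add: grad_def vec_eq_iff d1)
  then have "twist g' p v = dir_deriv v (dir_deriv (c *\<^sub>R w) g') p"
    by (simp add: twist_def w_def cross_mult_left)
  also have "\<dots> = c * dir_deriv v (dir_deriv w g') p"
    using dir_deriv2_sum[OF L'(1,3,2), of v w] dir_deriv2_sum[OF L'(1,3,2), of v "c *\<^sub>R w"]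
    by (simp add: sum_distrib_left mult_ac)
  also have "\<dots> = c\<^sup>2 * twist g p v" using polar by (simp add: twist_def w_def power2_eq_square)
  finally show ?thesis using c(1) by (intro exI[of _ "c\<^sup>2"]) simp
qed

section \<open>Handedness of asymptotic lines\<close>

lemma span_singleton_scale: "a \<noteq> 0 \<Longrightarrow> span {a *\<^sub>R v} = span {v :: 'a::real_vector}"
  using span_image_scale[of "{v}" "\<lambda>_. a"] by simp

lemma span_singleton_eqD:
  assumes "span {u} = span {v :: 'a::real_vector}" "u \<noteq> 0"
  obtains a where "a \<noteq> 0" "u = a *\<^sub>R v"
proof -
  have "u \<in> span {v}" using assms(1) span_base[of u "{u}"] by auto
  then obtain a where "u = a *\<^sub>R v" by (auto simp: span_singleton)
  then show ?thesis using that assms(2) by auto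
qed

text \<open>After projecting u off v and w, the remainder z is orthogonal to v, w and n. The triple
  product gives z x w = 0, whereas orthogonality makes its norm the product of the norms of z and
  w.\<close>

lemma orthogonal_decomposition_cross:
  fixes n u v :: "real^3"
  assumes "n \<bullet> v = 0" "n \<bullet> u = 0" "v \<noteq> 0" "n \<noteq> 0"
  defines "w \<equiv> cross3 n v"
  shows "w \<noteq> 0" "v \<bullet> w = 0" "\<exists>a b. u = a *\<^sub>R v + b *\<^sub>R w"
proof -
  have "(norm w)\<^sup>2 = (norm n * norm v)\<^sup>2"
    using norm_cross_dot[of n v] assms(1) by (simp add: w_def)
  then show w: "w \<noteq> 0" using assms(3,4) by auto
  show vw: "v \<bullet> w = 0" by (simp add: w_def dot_cross_self)
  have nw: "n \<bullet> w = 0" by (simp add: w_def dot_cross_self)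
  define z where "z = u - (u \<bullet> v / (v \<bullet> v)) *\<^sub>R v - (u \<bullet> w / (w \<bullet> w)) *\<^sub>R w"
  have z: "z \<bullet> v = 0" "z \<bullet> w = 0" "z \<bullet> n = 0"
    using vw nw assms(1-4) w inner_commute[of v w] inner_commute[of n w] inner_commute[of n v]
      inner_commute[of n u] by (simp_all add: z_def inner_diff_left)
  have "cross3 z w = (z \<bullet> v) *\<^sub>R n - (z \<bullet> n) *\<^sub>R v"
    unfolding w_def by (simp add: cross3_simps forall_3)
  then have "cross3 z w = 0" using z by simp
  then have "(norm z * norm w)\<^sup>2 = 0" using norm_cross_dot[of z w] z by simp
  then have "z = 0" using w by simp
  then have "u = (u \<bullet> v / (v \<bullet> v)) *\<^sub>R v + (u \<bullet> w / (w \<bullet> w)) *\<^sub>R w"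
    by (simp add: z_def algebra_simps)
  then show "\<exists>a b. u = a *\<^sub>R v + b *\<^sub>R w" by blast
qed

lemma grad_nonzero:
  assumes "p \<in> S" "local_equation S p W g"
  shows "grad g p \<noteq> 0"
proof
  note L = local_equationD[OF assms(2)]
  assume "grad g p = 0"
  then have "dir_deriv v g p = 0" for v using dir_deriv_inner_grad[OF L(3,2)] by simp
  then show False using L(5)[OF assms(1) L(2)] by blast
qed

text \<open>In the basis v, w of the tangent plane the Hessian is 2 a b times the twist plus b^2
  times its value at w. Without the first term it either vanishes identically, giving at least three
  asymptotic lines, or only on the line of v.\<close>

lemma twist_nonzero:
  assumes hyp: "hyperbolic_point S p" and g: "local_equation S p W g"
    and "v \<noteq> 0" "asymptotic_line S p (span {v})"
  shows "twist g p v \<noteq> 0"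
proof
  assume t0: "twist g p v = 0"
  note L = local_equationD[OF g]
  have "p \<in> S" and card: "card {L. asymptotic_line S p L} = 2"
    using hyp unfolding hyperbolic_point_def by auto
  note asy = asymptotic_line_iff[OF \<open>p \<in> S\<close> g]
  define n where "n = grad g p"
  define w where "w = cross3 n v"
  have gi: "dir_deriv u g p = n \<bullet> u" for u using dir_deriv_inner_grad[OF L(3,2)] by (simp add: n_def inner_commute)
  have v: "n \<bullet> v = 0" "dir_deriv v (dir_deriv v g) p = 0" using asy assms(3,4) gi by auto
  have "n \<noteq> 0" using grad_nonzero[OF \<open>p \<in> S\<close> g] by (simp add: n_def)
  note dec = orthogonal_decomposition_cross[OF v(1) _ assms(3) this, folded w_def]
  have w: "w \<noteq> 0" "v \<bullet> w = 0" "n \<bullet> w = 0"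
    using dec(1,2)[OF v(1)] by (simp_all add: w_def dot_cross_self)
  have vw: "dir_deriv v (dir_deriv w g) p = 0" using t0 by (simp add: twist_def w_def n_def)
  have q: "dir_deriv (a *\<^sub>R v + b *\<^sub>R w) (dir_deriv (a *\<^sub>R v + b *\<^sub>R w) g) p = b\<^sup>2 * dir_deriv w (dir_deriv w g) p" for a b
    using dir_deriv_pow2_lincomb[OF L(1,3,2), of a v b w] v(2) vw by simp
  show False
  proof (cases "dir_deriv w (dir_deriv w g) p = 0")
    case True
    have m: "asymptotic_line S p (span {a *\<^sub>R v + b *\<^sub>R w})" if "a *\<^sub>R v + b *\<^sub>R w \<noteq> 0" for a b
      using that asy q True gi v(1) w(3) by (simp add: inner_add_right)
    have ne: "span {v} \<noteq> span {w}" "span {v} \<noteq> span {v + w}" "span {w} \<noteq> span {v + w}"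
    proof -
      have no: "v \<noteq> a *\<^sub>R w" for a using w(2) assms(3) w(1) by (metis inner_eq_zero_iff inner_scaleR_right mult_zero_right scale_eq_0_iff inner_commute)
      then show "span {v} \<noteq> span {w}" using assms(3) span_singleton_eqD by metis
      show "span {v} \<noteq> span {v + w}"
      proof
        assume "span {v} = span {v + w}"
        then obtain a where a: "v = a *\<^sub>R (v + w)" using assms(3) span_singleton_eqD by metis
        have "w \<bullet> v = a * (w \<bullet> w)" by (subst a) (simp add: inner_add_right w(2) inner_commute)
        then have "a = 0" using w by (simp add: inner_commute)
        then show False using a assms(3) by simp
      qed
      show "span {w} \<noteq> span {v + w}"
      proof
        assume "span {w} = span {v + w}"
        then obtain a where a: "w = a *\<^sub>R (v + w)" using w(1) span_singleton_eqD by metis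
        have "v \<bullet> w = a * (v \<bullet> v)" by (subst a) (simp add: inner_add_right w(2) inner_commute)
        then have "a = 0" using w assms(3) by simp
        then show False using a w(1) by simp
      qed
    qed
    have "v + w \<noteq> 0"
    proof
      assume "v + w = 0"
      then have "v \<bullet> (v + w) = 0" by simp
      then show False using w(2) assms(3) by (simp add: inner_add_right)
    qed
    then have "{span {v}, span {w}, span {v + w}} \<subseteq> {L. asymptotic_line S p L}"
      using m[of 1 0] m[of 0 1] m[of 1 1] assms(3) w(1) by simp
    \<comment> \<open>Infinite sets have cardinality 0, so cardinality 2 includes
      finiteness.\<close>
    moreover have "finite {L. asymptotic_line S p L}" using card by (metis card.infinite zero_neq_numeral)
    ultimately have "card {span {v}, span {w}, span {v + w}} \<le> 2"
      using card_mono card by metis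
    then show False using ne by simp
  next
    case False
    have "{L. asymptotic_line S p L} \<subseteq> {span {v}}"
    proof
      fix L assume "L \<in> {L. asymptotic_line S p L}"
      then have "asymptotic_line S p L" by simp
      then obtain u where u: "u \<noteq> 0" "L = span {u}"
        unfolding asymptotic_line_def contact_at_least_def by blast
      then have du: "dir_deriv u g p = 0" "dir_deriv u (dir_deriv u g) p = 0"
        using asy[of u] \<open>asymptotic_line S p L\<close> by auto
      then obtain a b where ab: "u = a *\<^sub>R v + b *\<^sub>R w" using dec(3)[of u] gi by auto
      then have "b = 0" using du(2) q[of a b] False by simp
      then show "L \<in> {span {v}}" using u ab span_singleton_scale[of a v] by auto
    qed
    then have "card {L. asymptotic_line S p L} \<le> 1" using card_mono[of "{span {v}}"] by simp
    then show False using card by simp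
  qed
qed

section \<open>Asymptotic curves\<close>

lemma curve_deriv_Suc: "curve_deriv (Suc k) c t = vector_derivative (curve_deriv k c) (at t)"
  by (simp add: curve_deriv_def)

lemma smooth_on_curve_deriv:
  assumes "open I" "smooth_on c I"
  shows "smooth_on (curve_deriv k c) I"
    and "t \<in> I \<Longrightarrow> (curve_deriv k c has_vector_derivative curve_deriv (Suc k) c t) (at t)"
proof -
  have d: "(f has_vector_derivative dir_deriv 1 f t) (at t)" if "smooth_on f I" "t \<in> I" for f :: "real \<Rightarrow> real^3" and t
  proof -
    have "dir_deriv h f t = h *\<^sub>R dir_deriv 1 f t" for h
      using linear_scale[OF linear_dir_deriv[OF that], of h 1] by simp
    then have "(\<lambda>h. dir_deriv h f t) = (\<lambda>h. h *\<^sub>R dir_deriv 1 f t)" by (rule ext)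
    then show ?thesis using has_derivative_dir_deriv[OF that] unfolding has_vector_derivative_def by metis
  qed
  show s: "smooth_on (curve_deriv k c) I" for k
  proof (induction k)
    case 0
    then show ?case using assms by (simp add: curve_deriv_def)
  next
    case (Suc k)
    show ?case
      by (rule smooth_on_cong[OF assms(1) smooth_on_dir_deriv[OF Suc, of 1]])
        (simp add: curve_deriv_Suc vector_derivative_at[OF d[OF Suc]])
  qed
  show "(curve_deriv k c has_vector_derivative curve_deriv (Suc k) c t) (at t)" if "t \<in> I"
    using d[OF s that, of k] by (simp add: curve_deriv_Suc vector_derivative_at)
qed

lemma has_real_derivative_along:
  fixes g :: "'a::real_normed_vector \<Rightarrow> real"
  assumes "smooth_on g W" "c t \<in> W" "(c has_vector_derivative c') (at t)"
  shows "((\<lambda>t. g (c t)) has_real_derivative dir_deriv c' g (c t)) (at t)"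
proof -
  have "((\<lambda>t. g (c t)) has_derivative (\<lambda>h. dir_deriv (h *\<^sub>R c') g (c t))) (at t)"
    using has_derivative_compose[OF assms(3)[unfolded has_vector_derivative_def]
        has_derivative_dir_deriv[OF assms(1,2)]] .
  then show ?thesis
    using linear_scale[OF linear_dir_deriv[OF assms(1,2)]]
    by (simp add: has_field_derivative_def mult.commute[of _ "dir_deriv c' g (c t)"] mult_commute_abs)
qed

text \<open>Product rule for a moving direction at a moving point; in the second summand the
  direction u is frozen at time t. Coordinates turn the moving direction into scalar
  factors.\<close>

lemma dir_deriv_along:
  fixes g :: "real^3 \<Rightarrow> real"
  assumes "open W" "smooth_on g W" "c t \<in> W" "(c has_vector_derivative c') (at t)"
    and "(u has_vector_derivative u') (at t)"
  shows "((\<lambda>t. dir_deriv (u t) g (c t)) has_real_derivative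
    dir_deriv u' g (c t) + dir_deriv c' (dir_deriv (u t) g) (c t)) (at t)"
proof -
  have "((\<lambda>t. \<Sum>i\<in>UNIV. u t $ i * dir_deriv (axis i 1) g (c t)) has_real_derivative
      (\<Sum>i\<in>UNIV. u t $ i * dir_deriv c' (dir_deriv (axis i 1) g) (c t)
        + u' $ i * dir_deriv (axis i 1) g (c t))) (at t)"
  proof (intro DERIV_sum DERIV_mult')
    fix i :: 3
    show "((\<lambda>t. dir_deriv (axis i 1) g (c t)) has_real_derivative dir_deriv c' (dir_deriv (axis i 1) g) (c t)) (at t)"
      by (rule has_real_derivative_along[OF smooth_on_dir_deriv[OF assms(2)] assms(3,4)])
    show "((\<lambda>t. u t $ i) has_real_derivative u' $ i) (at t)"
      using bounded_linear.has_vector_derivative[OF bounded_linear_vec_nth assms(5)]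
      by (simp add: has_real_derivative_iff_has_vector_derivative)
  qed
  also have "(\<Sum>i\<in>UNIV. u t $ i * dir_deriv c' (dir_deriv (axis i 1) g) (c t)
        + u' $ i * dir_deriv (axis i 1) g (c t))
      = dir_deriv u' g (c t) + (\<Sum>i\<in>UNIV. u t $ i * dir_deriv (axis i 1) (dir_deriv c' g) (c t))"
    using dir_deriv_sum[OF assms(2,3), of u'] dir_deriv_commute[OF assms(1-3), of c']
    by (simp add: sum.distrib)
  also have "(\<Sum>i\<in>UNIV. u t $ i * dir_deriv (axis i 1) (dir_deriv c' g) (c t)) = dir_deriv c' (dir_deriv (u t) g) (c t)"
    using dir_deriv_sum[OF smooth_on_dir_deriv[OF assms(2)] assms(3), of "u t" c']
      dir_deriv_commute[OF assms(1-3), of c' "u t"] by simp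
  finally have "((\<lambda>t. \<Sum>i\<in>UNIV. u t $ i * dir_deriv (axis i 1) g (c t)) has_real_derivative
    dir_deriv u' g (c t) + dir_deriv c' (dir_deriv (u t) g) (c t)) (at t)" .
  moreover have "isCont c t" using assms(4) has_vector_derivative_continuous by blast
  then have "\<forall>\<^sub>F s in nhds t. c s \<in> W"
    using topological_tendstoD[OF _ assms(1,3)]
    unfolding isCont_def tendsto_at_iff_tendsto_nhds by blast
  then have "\<forall>\<^sub>F s in nhds t. dir_deriv (u s) g (c s) = (\<Sum>i\<in>UNIV. u s $ i * dir_deriv (axis i 1) g (c s))"
    by eventually_elim (rule dir_deriv_sum[OF assms(2)])
  ultimately show ?thesis by (subst DERIV_cong_ev[OF refl _ refl])
qed

text \<open>Along an asymptotic curve the tangent plane contains the first two derivatives, and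
  differentiating once more expresses the normal component of the third one by the second
  fundamental form.\<close>

lemma handed_curve_twist:
  assumes "U \<subseteq> S" and g: "local_equation S q W g" and "asymptotic_field S U X"
    and "asymptotic_curve U X q c" "handed_curve_at s c 0"
  shows "s * twist g q (X q) < 0"
proof -
  note L = local_equationD[OF g]
  obtain \<epsilon> where e: "\<epsilon> > 0" "smooth_on c {-\<epsilon><..<\<epsilon>}" "c 0 = q" and
    c: "\<And>t. t \<in> {-\<epsilon><..<\<epsilon>} \<Longrightarrow> c t \<in> U \<and> curve_deriv 1 c t \<noteq> 0 \<and> curve_deriv 1 c t \<in> span {X (c t)}"
    using assms(4) unfolding asymptotic_curve_def by blast
  \<comment> \<open>Times at which the curve is in the domain of the equation. The set is open, so
    identities on it may be differentiated.\<close>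
  define I where "I = {-\<epsilon><..<\<epsilon>} \<inter> c -` W"
  have "continuous_on {-\<epsilon><..<\<epsilon>} c" using smooth_on_continuous[OF e(2)] .
  then have "open I" unfolding I_def using L(1) by (auto intro: continuous_open_preimage)
  have "0 \<in> I" using e L(2) by (simp add: I_def)
  have sm: "smooth_on c I" using smooth_on_subset[OF e(2)] by (auto simp: I_def)
  note cd = smooth_on_curve_deriv(2)[OF \<open>open I\<close> sm]
  have cd0: "(c has_vector_derivative curve_deriv 1 c t) (at t)" if "t \<in> I" for t
    using cd[of t 0] that by (simp add: curve_deriv_def)
  have inW: "c t \<in> W" "c t \<in> S" if "t \<in> I" for t
    using that c assms(1) by (auto simp: I_def)
  have scale: "\<exists>k. k \<noteq> 0 \<and> curve_deriv 1 c t = k *\<^sub>R X (c t)" if "t \<in> I" for t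
    using c[of t] that unfolding I_def by (auto simp: span_singleton)
  have asy: "dir_deriv (curve_deriv 1 c t) g (c t) = 0 \<and>
      dir_deriv (curve_deriv 1 c t) (dir_deriv (curve_deriv 1 c t) g) (c t) = 0" if "t \<in> I" for t
  proof -
    have "asymptotic_line S (c t) (span {X (c t)})"
      using assms(3) c that unfolding asymptotic_field_def I_def by blast
    then have "asymptotic_line S (c t) (span {curve_deriv 1 c t})"
      using scale[OF that] span_singleton_scale by metis
    then show ?thesis
      using asymptotic_line_iff[OF inW(2)[OF that] L(6)[OF inW(1)[OF that]]] c that
      unfolding I_def by blast
  qed
  have const: "f' = 0" if "\<And>t. t \<in> I \<Longrightarrow> f t = (0::real)" "(f has_real_derivative f') (at t)" "t \<in> I" for f f' t
  proof -
    have "\<forall>\<^sub>F s in nhds t. f s = 0"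
      using eventually_nhds_in_open[OF \<open>open I\<close> that(3)] by eventually_elim (rule that(1))
    then have "(f has_real_derivative 0) (at t)"
      using DERIV_cong_ev[OF refl _ refl, of f "\<lambda>_. 0" t 0] by simp
    then show ?thesis using DERIV_unique that(2) by blast
  qed
  \<comment> \<open>The derivative of the tangency condition; its second summand vanishes because
    the tangent is asymptotic.\<close>
  have "dir_deriv (curve_deriv 2 c t) g (c t) + dir_deriv (curve_deriv 1 c t) (dir_deriv (curve_deriv 1 c t) g) (c t) = 0"
    if "t \<in> I" for t
    using const[OF _ dir_deriv_along[OF L(1,3) inW(1)[OF that] cd0[OF that] cd[OF that, of 1]] that] asy
    by (simp add: numeral_2_eq_2)
  then have d2: "dir_deriv (curve_deriv 2 c t) g (c t) = 0" if "t \<in> I" for t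
    using asy that by simp
  have d3: "dir_deriv (curve_deriv 3 c t) g (c t) + dir_deriv (curve_deriv 1 c t) (dir_deriv (curve_deriv 2 c t) g) (c t) = 0"
    if "t \<in> I" for t
    using const[OF _ dir_deriv_along[OF L(1,3) inW(1)[OF that] cd0[OF that] cd[OF that, of 2]] that] d2
    by (simp add: numeral_3_eq_3 numeral_2_eq_2)
  define c1 c2 c3 n w where "c1 = curve_deriv 1 c 0" "c2 = curve_deriv 2 c 0"
    "c3 = curve_deriv 3 c 0" "n = grad g q" "w = cross3 n c1"
  note defs = this
  have gi: "dir_deriv u g q = n \<bullet> u" for u
    using dir_deriv_inner_grad[OF L(3,2)] by (simp add: defs inner_commute)
  have n: "n \<bullet> c1 = 0" "n \<bullet> c2 = 0" "n \<bullet> c3 = - dir_deriv c1 (dir_deriv c2 g) q" "dir_deriv c1 (dir_deriv c1 g) q = 0"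
    using asy[OF \<open>0 \<in> I\<close>] d2[OF \<open>0 \<in> I\<close>] d3[OF \<open>0 \<in> I\<close>] unfolding e(3) gi defs[symmetric] by auto
  have "q \<in> S" using inW \<open>0 \<in> I\<close> e(3) by metis
  then have "n \<noteq> 0" using grad_nonzero[OF _ g] by (simp add: defs)
  have "c1 \<noteq> 0" using c e(1) by (simp add: defs)
  obtain a b where ab: "c2 = a *\<^sub>R c1 + b *\<^sub>R w"
    using orthogonal_decomposition_cross(3)[OF n(1,2) \<open>c1 \<noteq> 0\<close> \<open>n \<noteq> 0\<close>] defs by metis
  \<comment> \<open>Only the component of c2 along w = n x c1 counts, and c1 x w is a multiple of n,
    so the determinant sees just the normal component of c3.\<close>
  have "det (vector [c1, c2, c3] :: real^3^3) = cross3 c1 c2 \<bullet> c3"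
    by (simp add: cross3_simps)
  also have "cross3 c1 c2 = b *\<^sub>R cross3 c1 (cross3 n c1)"
    by (simp add: ab defs(5) cross_add_right cross_mult_right)
  also have "cross3 c1 (cross3 n c1) = (c1 \<bullet> c1) *\<^sub>R n - (n \<bullet> c1) *\<^sub>R c1"
    by (simp add: cross3_simps forall_3)
  finally have det: "det (vector [c1, c2, c3] :: real^3^3) = b * (c1 \<bullet> c1) * (n \<bullet> c3)"
    using n(1) by simp
  have "dir_deriv c1 (dir_deriv c2 g) q = dir_deriv c2 (dir_deriv c1 g) q" using dir_deriv_commute[OF L(1,3,2)] .
  also have "\<dots> = a * dir_deriv c1 (dir_deriv c1 g) q + b * dir_deriv w (dir_deriv c1 g) q"
    using dir_deriv_lincomb[OF smooth_on_dir_deriv[OF L(3)] L(2)] by (simp add: ab)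
  also have "\<dots> = b * twist g q c1"
    using n(4) dir_deriv_commute[OF L(1,3,2), of w c1] by (simp add: twist_def defs)
  finally have "det (vector [c1, c2, c3] :: real^3^3) = - (b\<^sup>2 * (c1 \<bullet> c1)) * twist g q c1"
    unfolding det n(3) by (simp add: power2_eq_square)
  moreover obtain k where k: "k \<noteq> 0" "c1 = k *\<^sub>R X q"
    using scale[OF \<open>0 \<in> I\<close>] e(3) by (auto simp: defs)
  ultimately have "s * det (vector [c1, c2, c3] :: real^3^3)
      = - ((b * k)\<^sup>2 * (c1 \<bullet> c1)) * (s * twist g q (X q))"
    using twist_scale[OF L(1,3,2), of k "X q"] by (simp add: power_mult_distrib)
  moreover have "s * det (vector [c1, c2, c3] :: real^3^3) > 0"
    using assms(5) by (simp add: handed_curve_at_def defs)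
  \<comment> \<open>A weak inequality is enough: if this factor were zero, so would be the
    determinant, against handedness.\<close>
  moreover have "(b * k)\<^sup>2 * (c1 \<bullet> c1) \<ge> 0" by simp
  ultimately show ?thesis by (smt (verit) mult_nonneg_nonneg mult_minus_left)
qed

lemma handed_twist:
  assumes surf: "smooth_surface S" and handed: "handed_asymptotic_line s S p (span {v})"
    and "v \<noteq> 0" and g: "local_equation S p W g"
  shows "s * twist g p v < 0" "asymptotic_line S p (span {v})" "hyperbolic_point S p"
proof -
  obtain U X q c where U: "openin (top_of_set S) U" "connected U" "p \<in> U" "q \<in> U"
    "asymptotic_field S U X" "span {v} = span {X p}" "asymptotic_curve U X q c" "handed_curve_at s c 0"
    using handed unfolding handed_asymptotic_line_def by blast
  have "U \<subseteq> S" using openin_imp_subset[OF U(1)] .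
  have X: "continuous_on U X" "\<And>r. r \<in> U \<Longrightarrow> hyperbolic_point S r \<and> X r \<noteq> 0 \<and> asymptotic_line S r (span {X r})"
    using U(5) unfolding asymptotic_field_def by auto
  show "asymptotic_line S p (span {v})" "hyperbolic_point S p" using X U(3,6) by auto
  \<comment> \<open>A local equation need not cover U, so one is chosen at each point; by
    \<open>rel\<close> the sign of the twist does not depend on the choice.\<close>
  define G where "G r = (SOME g. \<exists>W. local_equation S r W g)" for r
  have G: "\<exists>W. local_equation S r W (G r)" if "r \<in> U" for r
  proof -
    have "\<exists>g W. local_equation S r W g"
      using surf that \<open>U \<subseteq> S\<close> unfolding smooth_surface_def by blast
    then show ?thesis unfolding G_def by (rule someI_ex)
  qed
  have rel: "\<exists>d>0. twist g' r (X r) = d * twist g r (X r)"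
    if "r \<in> U" "local_equation S r W g" "local_equation S r W' g'" for r W W' g g'
    using twist_local_equation[OF _ that(2,3)] asymptotic_line_iff[OF _ that(2)] X(2)[OF that(1)]
      \<open>U \<subseteq> S\<close> that(1) by blast
  \<comment> \<open>Locally constant: the equation at r also serves nearby points, its twist keeps
    its sign by continuity, and \<open>rel\<close> passes to the equations chosen there.\<close>
  define \<sigma> where "\<sigma> r = sgn (twist (G r) r (X r))" for r
  have "\<forall>\<^sub>F r' in at r within U. \<sigma> r = \<sigma> r'" if r: "r \<in> U" for r
  proof -
    obtain W where W: "local_equation S r W (G r)" using G[OF r] by blast
    note L = local_equationD[OF W]
    have "((\<lambda>z. twist (G r) z (X z)) \<longlongrightarrow> twist (G r) r (X r)) (at r within U)"
      using X(1) r unfolding continuous_on_def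
      by (intro tendsto_twist[OF L(1,3,2)] tendsto_ident_at) auto
    moreover have nz: "twist (G r) r (X r) \<noteq> 0" using twist_nonzero[OF _ W] X(2)[OF r] by blast
    ultimately have "\<forall>\<^sub>F r' in at r within U. sgn (twist (G r) r' (X r')) = \<sigma> r"
    proof (cases "twist (G r) r (X r) > 0")
      case True
      show ?thesis
        using order_tendstoD(1)[OF \<open>(_ \<longlongrightarrow> _) _\<close> True] by eventually_elim (simp add: \<sigma>_def True)
    next
      case False
      then have "twist (G r) r (X r) < 0" using nz by simp
      from order_tendstoD(2)[OF \<open>(_ \<longlongrightarrow> _) _\<close> this] show ?thesis
        by eventually_elim (simp add: \<sigma>_def \<open>twist (G r) r (X r) < 0\<close>)
    qed
    moreover have "\<forall>\<^sub>F r' in at r within U. r' \<in> W \<and> r' \<in> U"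
      using eventually_nhds_in_open[OF L(1,2)] unfolding eventually_at_filter
      by (auto elim: eventually_mono)
    ultimately show ?thesis
    proof eventually_elim
      case (elim r')
      obtain W' where "local_equation S r' W' (G r')" using G elim by blast
      then obtain d where "d > 0" "twist (G r') r' (X r') = d * twist (G r) r' (X r')"
        using rel[of r' W "G r" W' "G r'"] elim L(6) by blast
      then show ?case using elim(1) by (simp add: \<sigma>_def sgn_mult)
    qed
  qed
  then have "\<sigma> q = \<sigma> p" using connected_local_const[OF U(2,4,3)] by blast
  obtain W1 where "local_equation S q W1 (G q)" using G[OF U(4)] by blast
  from handed_curve_twist[OF \<open>U \<subseteq> S\<close> this U(5,7,8)]
  have "sgn s * \<sigma> q = -1" unfolding \<sigma>_def by (metis sgn_mult sgn_neg)
  then have "sgn s * \<sigma> p = -1" unfolding \<open>\<sigma> q = \<sigma> p\<close> .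
  then have "sgn (s * twist (G p) p (X p)) = -1" unfolding \<sigma>_def by (simp add: sgn_mult)
  then have "s * twist (G p) p (X p) < 0" by (metis sgn_less sgn_1_neg)
  moreover obtain W2 where "local_equation S p W2 (G p)" using G[OF U(3)] by blast
  then obtain d where "d > 0" "twist g p (X p) = d * twist (G p) p (X p)" using rel[OF U(3) _ g] by blast
  ultimately have t: "s * twist g p (X p) < 0"
    by (metis mult.left_commute mult_pos_neg)
  obtain k where k: "k \<noteq> 0" "v = k *\<^sub>R X p" using span_singleton_eqD[OF U(6) assms(3)] by blast
  note L = local_equationD[OF g]
  have eq: "s * twist g p v = k\<^sup>2 * (s * twist g p (X p))"
    using twist_scale[OF L(1,3,2), of k "X p"] k by simp
  show "s * twist g p v < 0" unfolding eq by (rule mult_pos_neg[OF _ t]) (use k(1) in simp)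
qed

section \<open>Monge charts\<close>

text \<open>Eliminates the slope \<open>m\<close> of the asymptotic direction to first order in the parameter of the
  flecnodal curve; only continuity of \<open>B\<close>, \<dots>, \<open>J\<close> enters since \<open>m\<close> itself vanishes at \<open>0\<close>.\<close>

lemma common_root_derivative:
  fixes A B C D E K J :: "real \<Rightarrow> real"
  assumes ev: "\<forall>\<^sub>F t in at 0. \<exists>m. \<bar>m\<bar> \<le> 1 \<and> A t + 2 * B t * m + C t * m\<^sup>2 = 0 \<and>
      D t + 3 * E t * m + 3 * K t * m\<^sup>2 + J t * m ^ 3 = 0"
    and A: "(A has_real_derivative a) (at 0)" "A 0 = 0"
    and B: "(B \<longlongrightarrow> b) (at 0)" "b \<noteq> 0" and C: "(C \<longlongrightarrow> 0) (at 0)"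
    and D: "(D has_real_derivative d) (at 0)" "D 0 = 0"
    and E: "(E \<longlongrightarrow> e) (at 0)" and K: "(K \<longlongrightarrow> k) (at 0)" and J: "(J \<longlongrightarrow> j) (at 0)"
  shows "2 * b * d = 3 * e * a"
proof -
  \<comment> \<open>Chosen separately for each t, with no relation between neighbouring values; the
    behaviour at 0 is derived from the quadratic equation.\<close>
  define m where "m t = (SOME m. \<bar>m\<bar> \<le> 1 \<and> A t + 2 * B t * m + C t * m\<^sup>2 = 0 \<and>
      D t + 3 * E t * m + 3 * K t * m\<^sup>2 + J t * m ^ 3 = 0)" for t
  have m: "\<forall>\<^sub>F t in at 0. \<bar>m t\<bar> \<le> 1 \<and> A t + 2 * B t * m t + C t * (m t)\<^sup>2 = 0 \<and>
      D t + 3 * E t * m t + 3 * K t * (m t)\<^sup>2 + J t * (m t) ^ 3 = 0"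
    using ev unfolding m_def by eventually_elim (rule someI_ex)
  \<comment> \<open>The bound on m enters here: it makes C m small before m itself is known to tend
    to 0.\<close>
  have Cm: "((\<lambda>t. C t * m t) \<longlongrightarrow> 0) (at 0)"
  proof (rule Lim_null_comparison)
    show "\<forall>\<^sub>F t in at 0. norm (C t * m t) \<le> \<bar>C t\<bar>"
      using m by eventually_elim (simp add: abs_mult mult_left_le)
    show "((\<lambda>t. \<bar>C t\<bar>) \<longlongrightarrow> 0) (at 0)" using tendsto_rabs[OF C] by simp
  qed
  have den: "((\<lambda>t. 2 * B t + C t * m t) \<longlongrightarrow> 2 * b) (at 0)"
    using tendsto_add[OF tendsto_mult[OF tendsto_const[of 2] B(1)] Cm] by simp
  have At: "((\<lambda>t. A t / t) \<longlongrightarrow> a) (at 0)" "((\<lambda>t. D t / t) \<longlongrightarrow> d) (at 0)"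
    using A D by (simp_all add: has_field_derivative_iff)
  have nz: "\<forall>\<^sub>F t in at 0. 2 * B t + C t * m t \<noteq> 0"
    using tendsto_imp_eventually_ne[OF den, of 0] B(2) by simp
  \<comment> \<open>The quadratic is read as m (2 B + C m) = - A, whose bracket tends to 2
    b.\<close>
  have mt: "((\<lambda>t. m t / t) \<longlongrightarrow> - a / (2 * b)) (at 0)"
  proof (rule tendsto_cong[THEN iffD2])
    show "\<forall>\<^sub>F t in at 0. m t / t = - (A t / t) / (2 * B t + C t * m t)"
      using m nz
    proof eventually_elim
      case (elim t)
      have "m t * (2 * B t + C t * m t) = - A t"
        using elim by (simp add: algebra_simps power2_eq_square)
      then have "m t = - A t / (2 * B t + C t * m t)"
        using elim(2) nonzero_eq_divide_eq by blast
      then show ?case by (metis divide_divide_eq_left divide_minus_left mult.commute)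
    qed
    show "((\<lambda>t. - (A t / t) / (2 * B t + C t * m t)) \<longlongrightarrow> - a / (2 * b)) (at 0)"
      using B(2) by (intro tendsto_divide tendsto_minus At den) simp
  qed
  have m0: "(m \<longlongrightarrow> 0) (at 0)"
  proof (rule tendsto_cong[THEN iffD2])
    show "\<forall>\<^sub>F t in at 0. m t = m t / t * t" by (simp add: eventually_at_filter)
    show "((\<lambda>t. m t / t * t) \<longlongrightarrow> 0) (at 0)"
      using tendsto_mult[OF mt tendsto_ident_at] by simp
  qed
  \<comment> \<open>After division of the cubic by t, one factor m per term absorbs 1/t; the terms
    of degree 2 and 3 keep a further factor tending to 0.\<close>
  have lim: "((\<lambda>t. D t / t + 3 * E t * (m t / t) + 3 * K t * (m t * (m t / t))
      + J t * ((m t)\<^sup>2 * (m t / t))) \<longlongrightarrow>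
      d + 3 * e * (- a / (2 * b)) + 3 * k * (0 * (- a / (2 * b))) + j * (0\<^sup>2 * (- a / (2 * b)))) (at 0)"
    by (intro tendsto_add tendsto_mult tendsto_power tendsto_const At E K J mt m0)
  have ev0: "\<forall>\<^sub>F t in at 0. D t / t + 3 * E t * (m t / t) + 3 * K t * (m t * (m t / t))
      + J t * ((m t)\<^sup>2 * (m t / t)) = 0"
    using m
  proof eventually_elim
    case (elim t)
    have "D t / t + 3 * E t * (m t / t) + 3 * K t * (m t * (m t / t)) + J t * ((m t)\<^sup>2 * (m t / t))
      = (D t + 3 * E t * m t + 3 * K t * (m t)\<^sup>2 + J t * (m t) ^ 3) / t"
      by (simp add: add_divide_distrib power2_eq_square power3_eq_cube)
    then show ?case using elim by simp
  qed
  have "d + 3 * e * (- a / (2 * b)) + 3 * k * (0 * (- a / (2 * b))) + j * (0\<^sup>2 * (- a / (2 * b))) = 0"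
    by (rule tendsto_unique[OF _ iffD1[OF tendsto_cong[OF ev0] lim] tendsto_const]) simp
  then have "d + 3 * e * (- a / (2 * b)) = 0" by simp
  then show ?thesis using B(2) by (simp add: field_simps)
qed

text \<open>Each determinant of two generators is their two scale factors times the difference of
  parameters times D a b. Both sides then carry the same product of scale factors and the square of
  D a b, so the basis disappears from the multiplied form.\<close>

lemma cross_ratio_determinants:
  fixes X Y :: "real^3 \<Rightarrow> real"
  assumes "linear X" "linear Y" "has_cross_ratio (span {u1}) (span {u2}) (span {u3}) (span {u4}) r"
  defines "D \<equiv> \<lambda>u v. X u * Y v - X v * Y u"
  shows "r * (D u1 u4 * D u2 u3) = D u1 u3 * D u2 u4"
proof -
  obtain a b x1 x2 x3 x4 where
    sp: "span {u1} = span {a + x1 *\<^sub>R b}" "span {u2} = span {a + x2 *\<^sub>R b}"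
      "span {u3} = span {a + x3 *\<^sub>R b}" "span {u4} = span {a + x4 *\<^sub>R b}"
    and ne: "x1 \<noteq> x4" "x2 \<noteq> x3"
    and r: "r = ((x1 - x3) * (x2 - x4)) / ((x1 - x4) * (x2 - x3))"
    using assms(3) unfolding has_cross_ratio_def by blast
  have ex: "\<exists>k. u = k *\<^sub>R (a + x *\<^sub>R b)" if "span {u} = span {a + x *\<^sub>R b}" for u x
  proof -
    have "u \<in> span {a + x *\<^sub>R b}" using that span_base[of u "{u}"] by auto
    then show ?thesis by (auto simp: span_singleton)
  qed
  obtain k1 k2 k3 k4 where u: "u1 = k1 *\<^sub>R (a + x1 *\<^sub>R b)" "u2 = k2 *\<^sub>R (a + x2 *\<^sub>R b)"
    "u3 = k3 *\<^sub>R (a + x3 *\<^sub>R b)" "u4 = k4 *\<^sub>R (a + x4 *\<^sub>R b)"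
    using sp ex by metis
  have D: "D (k *\<^sub>R (a + x *\<^sub>R b)) (l *\<^sub>R (a + y *\<^sub>R b)) = k * l * (y - x) * D a b" for k l x y
    unfolding D_def
    by (simp add: linear_add[OF assms(1)] linear_add[OF assms(2)] linear_scale[OF assms(1)]
        linear_scale[OF assms(2)] algebra_simps)
  have "r * ((x1 - x4) * (x2 - x3)) = (x1 - x3) * (x2 - x4)" using r ne by simp
  then show ?thesis unfolding u D by algebra
qed

abbreviation fst_dir :: "real \<times> real" where "fst_dir \<equiv> (1, 0)"
abbreviation snd_dir :: "real \<times> real" where "snd_dir \<equiv> (0, 1)"

section \<open>Coordinates and local equation of a Monge chart\<close>

locale monge_chart =
  fixes S :: "(real^3) set" and h e1 e2 e3 :: "real^3" and f :: "real \<Rightarrow> real \<Rightarrow> real"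
    and W :: "(real^3) set" and V :: "(real \<times> real) set"
  assumes det_nz: "det (vector [e1, e2, e3] :: real^3^3) \<noteq> 0"
    and f0: "f 0 0 = 0" and df0: "((\<lambda>(x, y). f x y) has_derivative (\<lambda>_. 0)) (at (0, 0))"
    and openW: "open W" and hW: "h \<in> W" and openV: "open V" and zeroV: "(0, 0) \<in> V"
    and smooth_f: "smooth_on (\<lambda>(x, y). f x y) V"
    and graph: "S \<inter> W = (\<lambda>(x, y). h + x *\<^sub>R e1 + y *\<^sub>R e2 + f x y *\<^sub>R e3) ` V"
begin

definition frame_det :: real where "frame_det = e1 \<bullet> cross3 e2 e3"
text \<open>With \<open>yc\<close> and \<open>zc\<close> this is the dual basis of the frame by
  Cramer's rule.\<close>

definition xc :: "real^3 \<Rightarrow> real" where "xc v = (cross3 e2 e3 \<bullet> v) / frame_det"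
definition yc :: "real^3 \<Rightarrow> real" where "yc v = (cross3 e3 e1 \<bullet> v) / frame_det"
definition zc :: "real^3 \<Rightarrow> real" where "zc v = (cross3 e1 e2 \<bullet> v) / frame_det"
definition xy :: "real^3 \<Rightarrow> real \<times> real" where "xy v = (xc v, yc v)"

text \<open>The order of differentiation is that of \<open>partial\<close>, but the point varies,
  since jets are differentiated along the flecnodal curve.\<close>

definition jet :: "nat \<Rightarrow> nat \<Rightarrow> real \<times> real \<Rightarrow> real" where
  "jet i j = (dir_deriv fst_dir ^^ i) ((dir_deriv snd_dir ^^ j) (\<lambda>(x, y). f x y))"

text \<open>The function z - f(x, y) in coordinates centred at h. Differences are written with
  \<open>+ -\<close> to match the form T x + c of the affine substitution lemmas.\<close>

definition eqn :: "real^3 \<Rightarrow> real" where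
  "eqn q = (zc q + - zc h) - (case xy q + - xy h of (x, y) \<Rightarrow> f x y)"

text \<open>Outside V the values of f are unconstrained and zeros of \<open>eqn\<close> need not lie
  on S, hence the second condition.\<close>

definition W' :: "(real^3) set" where "W' = W \<inter> {q. xy q + - xy h \<in> V}"

lemma frame_det_nz: "frame_det \<noteq> 0"
  using det_nz by (simp add: frame_det_def dot_cross_det)

lemma coords_frame:
  "xc e1 = 1" "xc e2 = 0" "xc e3 = 0" "yc e1 = 0" "yc e2 = 1" "yc e3 = 0"
  "zc e1 = 0" "zc e2 = 0" "zc e3 = 1"
proof -
  have "cross3 e2 e3 \<bullet> e1 = frame_det" "cross3 e3 e1 \<bullet> e2 = frame_det" "cross3 e1 e2 \<bullet> e3 = frame_det"
    by (simp_all add: frame_det_def cross3_simps)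
  then show "xc e1 = 1" "xc e2 = 0" "xc e3 = 0" "yc e1 = 0" "yc e2 = 1" "yc e3 = 0"
    "zc e1 = 0" "zc e2 = 0" "zc e3 = 1"
    using frame_det_nz by (simp_all add: xc_def yc_def zc_def dot_cross_self)
qed

lemma bounded_linear_coords: "bounded_linear xc" "bounded_linear yc" "bounded_linear zc" "bounded_linear xy"
proof -
  have *: "bounded_linear (\<lambda>v. (u \<bullet> v) / frame_det)" for u :: "real^3"
    using bounded_linear_compose[OF bounded_linear_divide bounded_linear_inner_right] .
  then show "bounded_linear xc" "bounded_linear yc" "bounded_linear zc"
    unfolding xc_def yc_def zc_def by auto
  then show "bounded_linear xy" unfolding xy_def by (auto intro: bounded_linear_Pair)
qed

lemmas linear_coords = bounded_linear_coords[THEN bounded_linear.linear]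

lemma coords_linear [simp]:
  "xc (u + v) = xc u + xc v" "yc (u + v) = yc u + yc v" "zc (u + v) = zc u + zc v" "xy (u + v) = xy u + xy v"
  "xc (c *\<^sub>R v) = c * xc v" "yc (c *\<^sub>R v) = c * yc v" "zc (c *\<^sub>R v) = c * zc v" "xy (c *\<^sub>R v) = c *\<^sub>R xy v"
  "xc (u - v) = xc u - xc v" "yc (u - v) = yc u - yc v" "zc (u - v) = zc u - zc v"
  using linear_coords by (simp_all add: linear_add linear_scale linear_diff)

lemma frame_expansion: "v = xc v *\<^sub>R e1 + yc v *\<^sub>R e2 + zc v *\<^sub>R e3"
proof -
  have "frame_det *\<^sub>R v = (cross3 e2 e3 \<bullet> v) *\<^sub>R e1 + (cross3 e3 e1 \<bullet> v) *\<^sub>R e2 + (cross3 e1 e2 \<bullet> v) *\<^sub>R e3"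
    by (simp add: frame_det_def cross3_simps forall_3)
  then have "(1 / frame_det) *\<^sub>R (frame_det *\<^sub>R v) = xc v *\<^sub>R e1 + yc v *\<^sub>R e2 + zc v *\<^sub>R e3"
    by (simp add: xc_def yc_def zc_def scaleR_add_right)
  then show ?thesis using frame_det_nz by simp
qed

lemma xy_frame: "xy e1 = (1, 0)" "xy e2 = (0, 1)" "xy e3 = (0, 0)"
  by (simp_all add: xy_def coords_frame)

lemma openW': "open W'"
proof -
  have "continuous_on UNIV (\<lambda>q. xy q + - xy h)"
    by (intro continuous_intros linear_continuous_on bounded_linear_coords)
  then have "open ((\<lambda>q. xy q + - xy h) -` V)" using openV by (simp add: open_vimage)
  then show ?thesis unfolding W'_def using openW by (simp add: open_Int vimage_def)
qed

lemma hW': "h \<in> W'" using hW zeroV by (simp add: W'_def zero_prod_def)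

lemma W'V: "q \<in> W' \<Longrightarrow> xy q + - xy h \<in> V" by (simp add: W'_def)

lemma smooth_jet: "smooth_on (jet i j) V"
  unfolding jet_def by (intro smooth_on_dir_deriv_pow smooth_f)

lemma smooth_eqn: "smooth_on eqn W'"
  unfolding eqn_def
  by (intro smooth_on_diff openW' smooth_on_compose_affine[OF bounded_linear_coords(4) openW' _ smooth_f]
      smooth_on_compose_affine[OF bounded_linear_coords(3) openW' _ smooth_on_linear[OF bounded_linear_ident]] W'V)
    auto

lemma eqn_dir_deriv:
  assumes "q \<in> W'"
  shows "dir_deriv v eqn q = zc v - dir_deriv (xy v) (\<lambda>(x, y). f x y) (xy q + - xy h)"
proof -
  have "((\<lambda>q. zc q + - zc h) has_derivative zc) (at q)"
    using bounded_linear_imp_has_derivative[OF bounded_linear_coords(3)]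
    by (auto intro!: derivative_eq_intros)
  from has_derivative_diff[OF this has_derivative_compose_affine[OF bounded_linear_coords(4)
        smooth_on_differentiable[OF smooth_f W'V[OF assms]]]]
  show ?thesis unfolding eqn_def[abs_def] by (rule dir_deriv_eqI)
qed

lemma eqn_dir_deriv2:
  assumes "q \<in> W'"
  shows "dir_deriv u (dir_deriv v eqn) q = - dir_deriv (xy u) (dir_deriv (xy v) (\<lambda>(x, y). f x y)) (xy q + - xy h)"
proof -
  have "dir_deriv u (dir_deriv v eqn) q = dir_deriv u (\<lambda>q. zc v - dir_deriv (xy v) (\<lambda>(x, y). f x y) (xy q + - xy h)) q"
    by (rule dir_deriv_cong_open[OF openW' assms eqn_dir_deriv])
  also have "\<dots> = 0 - dir_deriv (xy u) (dir_deriv (xy v) (\<lambda>(x, y). f x y)) (xy q + - xy h)"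
    by (rule dir_deriv_eqI, rule has_derivative_diff[OF has_derivative_const
          has_derivative_compose_affine[OF bounded_linear_coords(4)
            smooth_on_differentiable[OF smooth_on_dir_deriv[OF smooth_f] W'V[OF assms]]]])
  finally show ?thesis by simp
qed

text \<open>The linear part \<open>zc\<close> contributes to the first derivative only; from order
  two on only - f is left.\<close>

lemma eqn_dir_deriv_pow:
  assumes "q \<in> W'" "k \<ge> 2"
  shows "(dir_deriv v ^^ k) eqn q = - (dir_deriv (xy v) ^^ k) (\<lambda>(x, y). f x y) (xy q + - xy h)"
  using assms(2,1)
proof (induction k arbitrary: q rule: dec_induct)
  case base
  then show ?case using eqn_dir_deriv2 by (simp add: numeral_2_eq_2)
next
  case (step k)
  have "dir_deriv v ((dir_deriv v ^^ k) eqn) q = dir_deriv v (\<lambda>q. - (dir_deriv (xy v) ^^ k) (\<lambda>(x, y). f x y) (xy q + - xy h)) q"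
    by (rule dir_deriv_cong_open[OF openW' step.prems step.IH])
  also have "\<dots> = - dir_deriv (xy v) ((dir_deriv (xy v) ^^ k) (\<lambda>(x, y). f x y)) (xy q + - xy h)"
    by (rule dir_deriv_eqI, rule has_derivative_minus[OF has_derivative_compose_affine[OF bounded_linear_coords(4)
            smooth_on_differentiable[OF smooth_on_dir_deriv_pow[OF smooth_f] W'V[OF step.prems]]]])
  finally show ?case by simp
qed

lemma local_equation_eqn: "q \<in> W' \<Longrightarrow> local_equation S q W' eqn"
  unfolding local_equation_def
proof (intro conjI openW' smooth_eqn ballI)
  show "S \<inter> W' = {q \<in> W'. eqn q = 0}"
  proof (intro set_eqI iffI)
    fix q assume q: "q \<in> S \<inter> W'"
    then obtain x y where "q = h + x *\<^sub>R e1 + y *\<^sub>R e2 + f x y *\<^sub>R e3"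
      using graph unfolding W'_def by fastforce
    then have "eqn q = 0"
      by (simp add: eqn_def coords_frame xy_frame)
    then show "q \<in> {q \<in> W'. eqn q = 0}" using q by simp
  next
    fix q assume "q \<in> {q \<in> W'. eqn q = 0}"
    then have q: "q \<in> W'" "eqn q = 0" by auto
    define x y where "x = xc q - xc h" "y = yc q - yc h"
    have xy: "xy q + - xy h = (x, y)" by (simp add: xy_def x_y_def)
    have "zc q - zc h = f x y" using q(2) unfolding eqn_def xy by simp
    then have "q = h + x *\<^sub>R e1 + y *\<^sub>R e2 + f x y *\<^sub>R e3"
      using frame_expansion[of "q - h"] by (simp add: x_y_def algebra_simps)
    moreover have "(x, y) \<in> V" using W'V[OF q(1)] xy by simp
    ultimately have "q \<in> S \<inter> W" unfolding graph by force
    then show "q \<in> S \<inter> W'" using q by simp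
  qed
  fix q assume "q \<in> S \<inter> W'"
  then have "dir_deriv e3 eqn q = 1"
    using eqn_dir_deriv[of q e3] linear_0[OF linear_dir_deriv[OF smooth_f W'V]]
    by (simp add: coords_frame xy_frame zero_prod_def)
  then show "\<exists>v. frechet_derivative eqn (at q) v \<noteq> 0" unfolding dir_deriv_def by (metis zero_neq_one)
qed auto

lemma hS: "h \<in> S"
  using local_equationD(4)[OF local_equation_eqn[OF hW'] hW']
  by (simp add: eqn_def f0 zero_prod_def)

lemma xy_h: "xy h + - xy h = (0, 0)" by (simp add: zero_prod_def)

text \<open>The inner y-derivatives have to be identified at (x, 0) for all x near 0 before the
  outer derivatives can be compared.\<close>

lemma partial_jet: "partial f i j = jet i j (0, 0)"
proof -
  have 1: "(deriv ^^ j) (f x) 0 = (dir_deriv snd_dir ^^ j) (\<lambda>(x, y). f x y) (x, 0)" if "(x, 0) \<in> V" for x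
    using deriv_pow_line[OF openV smooth_f, of "(x, 0)" 0 snd_dir j] that by simp
  have "open {t. (0, 0) + t *\<^sub>R fst_dir \<in> V}" by (rule open_line[OF openV])
  then have "\<forall>\<^sub>F x in nhds 0. (x, 0) \<in> V"
    using eventually_nhds_in_open[of "{t. (0, 0) + t *\<^sub>R fst_dir \<in> V}" 0] zeroV by simp
  then have "\<forall>\<^sub>F x in nhds 0. (deriv ^^ j) (f x) 0 = (dir_deriv snd_dir ^^ j) (\<lambda>(x, y). f x y) (x, 0)"
    by eventually_elim (rule 1)
  then have "partial f i j = (deriv ^^ i) (\<lambda>x. (dir_deriv snd_dir ^^ j) (\<lambda>(x, y). f x y) (x, 0)) 0"
    unfolding partial_def by (rule higher_deriv_cong_ev) simp
  also have "\<dots> = jet i j (0, 0)"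
    using deriv_pow_line[OF openV smooth_on_dir_deriv_pow[OF smooth_f], of "(0, 0)" 0 fst_dir i j snd_dir] zeroV
    by (simp add: jet_def)
  finally show ?thesis .
qed

lemma dir_deriv_jet: "z \<in> V \<Longrightarrow> dir_deriv (a, b) (jet i j) z = a * jet (Suc i) j z + b * jet i (Suc j) z"
proof -
  assume z: "z \<in> V"
  have "dir_deriv (a *\<^sub>R fst_dir + b *\<^sub>R snd_dir) (jet i j) z = a * jet (Suc i) j z + b * dir_deriv snd_dir (jet i j) z"
    unfolding dir_deriv_lincomb[OF smooth_jet z] by (simp add: jet_def)
  moreover have "dir_deriv snd_dir (jet i j) z = jet i (Suc j) z"
    using dir_deriv_pow_commute1[OF openV smooth_on_dir_deriv_pow[OF smooth_f] z] by (simp add: jet_def)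
  ultimately show ?thesis by simp
qed

lemma jet_00: "jet 0 0 = (\<lambda>(x, y). f x y)" by (simp add: jet_def)

lemma jet_first: "jet (Suc 0) 0 (0, 0) = 0" "jet 0 (Suc 0) (0, 0) = 0"
  using dir_deriv_jet[OF zeroV, of 1 0 0 0] dir_deriv_jet[OF zeroV, of 0 1 0 0] dir_deriv_eqI[OF df0] by (simp_all add: jet_00)

lemma dir_deriv2_f:
  assumes "z \<in> V"
  shows "(dir_deriv (a, b) ^^ 2) (\<lambda>(x, y). f x y) z = a\<^sup>2 * jet 2 0 z + 2 * a * b * jet 1 1 z + b\<^sup>2 * jet 0 2 z"
  using dir_deriv_pow2_lincomb[OF openV smooth_f assms, of a fst_dir b snd_dir]
  by (simp add: jet_def numeral_2_eq_2)

lemma dir_deriv3_f: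
  assumes "z \<in> V"
  shows "(dir_deriv (a, b) ^^ 3) (\<lambda>(x, y). f x y) z =
    a^3 * jet 3 0 z + 3 * a\<^sup>2 * b * jet 2 1 z + 3 * a * b\<^sup>2 * jet 1 2 z + b^3 * jet 0 3 z"
  using dir_deriv_pow3_lincomb[OF openV smooth_f assms, of a fst_dir b snd_dir]
  by (simp add: jet_def)

lemma e_nz: "e1 \<noteq> 0" "e2 \<noteq> 0" "e3 \<noteq> 0"
  using coords_frame linear_coords linear_0 by (metis zero_neq_one)+

lemma eqn_at_h:
  "dir_deriv v eqn h = zc v" "eqn h = 0"
  "k \<ge> 2 \<Longrightarrow> (dir_deriv e1 ^^ k) eqn h = - jet k 0 (0, 0)"
  "k \<ge> 2 \<Longrightarrow> (dir_deriv e2 ^^ k) eqn h = - jet 0 k (0, 0)"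
proof -
  show "dir_deriv v eqn h = zc v" using eqn_dir_deriv[OF hW'] dir_deriv_eqI[OF df0] by (simp add: zero_prod_def)
  show "eqn h = 0" by (simp add: eqn_def f0 zero_prod_def)
  show "(dir_deriv e1 ^^ k) eqn h = - jet k 0 (0, 0)" if "k \<ge> 2"
    using eqn_dir_deriv_pow[OF hW' that] by (simp add: jet_def xy_frame zero_prod_def)
  show "(dir_deriv e2 ^^ k) eqn h = - jet 0 k (0, 0)" if "k \<ge> 2"
    using eqn_dir_deriv_pow[OF hW' that] by (simp add: jet_def xy_frame zero_prod_def)
qed

text \<open>Orders 0 and 1 vanish automatically, as the axes are tangent lines at h.\<close>

lemma contact_axis:
  "contact_at_least S h (span {e1}) k \<longleftrightarrow> (\<forall>j. 2 \<le> j \<and> j < k \<longrightarrow> jet j 0 (0, 0) = 0)"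
  "contact_at_least S h (span {e2}) k \<longleftrightarrow> (\<forall>j. 2 \<le> j \<and> j < k \<longrightarrow> jet 0 j (0, 0) = 0)"
proof -
  have split: "(\<forall>j<k. P j) \<longleftrightarrow> (\<forall>j. 2 \<le> j \<and> j < k \<longrightarrow> P j)" if "P 0" "P 1" for P :: "nat \<Rightarrow> bool"
    using that by (metis One_nat_def less_2_cases not_le)
  show "contact_at_least S h (span {e1}) k \<longleftrightarrow> (\<forall>j. 2 \<le> j \<and> j < k \<longrightarrow> jet j 0 (0, 0) = 0)"
    unfolding contact_at_least_iff[OF hS local_equation_eqn[OF hW'] e_nz(1)]
    by (subst split) (auto simp: eqn_at_h coords_frame)
  show "contact_at_least S h (span {e2}) k \<longleftrightarrow> (\<forall>j. 2 \<le> j \<and> j < k \<longrightarrow> jet 0 j (0, 0) = 0)"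
    unfolding contact_at_least_iff[OF hS local_equation_eqn[OF hW'] e_nz(2)]
    by (subst split) (auto simp: eqn_at_h coords_frame)
qed

lemma span_frame: "span {e1} \<noteq> span {e2}" "span {e1 + e2} \<noteq> span {e1}" "span {e1 + e2} \<noteq> span {e2}"
proof -
  show "span {e1} \<noteq> span {e2}"
  proof
    assume "span {e1} = span {e2}"
    then obtain a where "e1 = a *\<^sub>R e2" using span_singleton_eqD e_nz by metis
    then have "xc e1 = a * xc e2" by (metis coords_linear(5))
    then show False by (simp add: coords_frame)
  qed
  show "span {e1 + e2} \<noteq> span {e1}"
  proof
    assume "span {e1 + e2} = span {e1}"
    then have "e1 + e2 \<in> span {e1}" using span_base[of "e1 + e2" "{e1 + e2}"] by auto
    then obtain a where "e1 + e2 = a *\<^sub>R e1" by (auto simp: span_singleton)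
    then have "yc (e1 + e2) = a * yc e1" by simp
    then show False by (simp add: coords_frame)
  qed
  show "span {e1 + e2} \<noteq> span {e2}"
  proof
    assume "span {e1 + e2} = span {e2}"
    then have "e1 + e2 \<in> span {e2}" using span_base[of "e1 + e2" "{e1 + e2}"] by auto
    then obtain a where "e1 + e2 = a *\<^sub>R e2" by (auto simp: span_singleton)
    then have "xc (e1 + e2) = a * xc e2" by simp
    then show False by (simp add: coords_frame)
  qed
qed

end

lemma handed_asymptotic_line_span:
  assumes "handed_asymptotic_line s S p L"
  obtains v where "v \<noteq> 0" "L = span {v}"
  using assms unfolding handed_asymptotic_line_def asymptotic_field_def by blast

section \<open>Exchange of the two axes\<close>

text \<open>Lets results about the axis e1 be reused for e2. The exchange reverses the orientation
  of the frame, which a chart permits.\<close>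

lemma monge_chart_swap:
  assumes "monge_chart S h e1 e2 e3 f W V"
  shows "monge_chart S h e2 e1 e3 (\<lambda>x y. f y x) W (prod.swap -` V)"
proof -
  interpret monge_chart S h e1 e2 e3 f W V by fact
  have bl: "bounded_linear (prod.swap :: real \<times> real \<Rightarrow> real \<times> real)"
    unfolding prod.swap_def[abs_def] by (intro bounded_linear_Pair bounded_linear_fst bounded_linear_snd)
  have eq: "(\<lambda>(x, y). f y x) = (\<lambda>z. (\<lambda>(x, y). f x y) (prod.swap z + 0))" by auto
  have op: "open (prod.swap -` V)"
    using openV linear_continuous_on[OF bl, of UNIV] by (simp add: open_vimage)
  show ?thesis
  proof
    show "det (vector [e2, e1, e3] :: real^3^3) \<noteq> 0"
      using frame_det_nz unfolding frame_det_def by (simp add: cross3_simps)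
    show "f 0 0 = 0" "open W" "h \<in> W" "open (prod.swap -` V)" "(0, 0) \<in> prod.swap -` V"
      using f0 openW hW zeroV op by auto
    show "((\<lambda>(x, y). f y x) has_derivative (\<lambda>_. 0)) (at (0, 0))"
    proof -
      have "((\<lambda>(x, y). f x y) has_derivative (\<lambda>_. 0)) (at (prod.swap (0, 0)))" using df0 by simp
      from has_derivative_compose[OF bounded_linear_imp_has_derivative[OF bl] this]
      show ?thesis unfolding eq by simp
    qed
    show "smooth_on (\<lambda>(x, y). f y x) (prod.swap -` V)"
      unfolding eq by (rule smooth_on_compose_affine[OF bl op _ smooth_f]) simp
    have "(\<lambda>(x, y). h + x *\<^sub>R e2 + y *\<^sub>R e1 + f y x *\<^sub>R e3) ` (prod.swap -` V)
        = (\<lambda>(x, y). h + x *\<^sub>R e1 + y *\<^sub>R e2 + f x y *\<^sub>R e3) ` V"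
    proof (intro set_eqI iffI)
      fix q assume "q \<in> (\<lambda>(x, y). h + x *\<^sub>R e2 + y *\<^sub>R e1 + f y x *\<^sub>R e3) ` (prod.swap -` V)"
      then obtain x y where "(y, x) \<in> V" "q = h + x *\<^sub>R e2 + y *\<^sub>R e1 + f y x *\<^sub>R e3" by auto
      then show "q \<in> (\<lambda>(x, y). h + x *\<^sub>R e1 + y *\<^sub>R e2 + f x y *\<^sub>R e3) ` V"
        by (intro image_eqI[of _ _ "(y, x)"]) (auto simp: add_ac)
    next
      fix q assume "q \<in> (\<lambda>(x, y). h + x *\<^sub>R e1 + y *\<^sub>R e2 + f x y *\<^sub>R e3) ` V"
      then obtain x y where "(x, y) \<in> V" "q = h + x *\<^sub>R e1 + y *\<^sub>R e2 + f x y *\<^sub>R e3" by auto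
      then show "q \<in> (\<lambda>(x, y). h + x *\<^sub>R e2 + y *\<^sub>R e1 + f y x *\<^sub>R e3) ` (prod.swap -` V)"
        by (intro image_eqI[of _ _ "(y, x)"]) (auto simp: add_ac)
    qed
    then show "S \<inter> W = (\<lambda>(x, y). h + x *\<^sub>R e2 + y *\<^sub>R e1 + f y x *\<^sub>R e3) ` (prod.swap -` V)"
      using graph by simp
  qed
qed

text \<open>\<open>partial\<close> records the order of differentiation and the exchange reverses
  it, so the symmetry of mixed derivatives enters.\<close>

lemma partial_swap:
  assumes "monge_chart S h e1 e2 e3 f W V"
  shows "partial (\<lambda>x y. f y x) i j = partial f j i"
proof -
  interpret monge_chart S h e1 e2 e3 f W V by fact
  interpret sw: monge_chart S h e2 e1 e3 "\<lambda>x y. f y x" W "prod.swap -` V"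
    by (rule monge_chart_swap[OF assms])
  have bl: "bounded_linear (prod.swap :: real \<times> real \<Rightarrow> real \<times> real)"
    unfolding prod.swap_def[abs_def] by (intro bounded_linear_Pair bounded_linear_fst bounded_linear_snd)
  have eq: "(\<lambda>(x, y). f y x) = (\<lambda>z. (\<lambda>(x, y). f x y) (prod.swap z + 0))" by auto
  have V: "prod.swap x + 0 \<in> V" if "x \<in> prod.swap -` V" for x using that by simp
  have "sw.jet i j (0, 0) = (dir_deriv fst_dir ^^ i) (\<lambda>z. (dir_deriv fst_dir ^^ j) (\<lambda>(x, y). f x y) (prod.swap z + 0)) (0, 0)"
    unfolding sw.jet_def eq
    by (rule dir_deriv_pow_cong_open[OF sw.openV sw.zeroV])
      (use dir_deriv_pow_compose_affine[OF bl sw.openV V smooth_f, where v = snd_dir and k = j] in simp)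
  also have "\<dots> = (dir_deriv snd_dir ^^ i) ((dir_deriv fst_dir ^^ j) (\<lambda>(x, y). f x y)) (0, 0)"
    using dir_deriv_pow_compose_affine[OF bl sw.openV V
      smooth_on_dir_deriv_pow[OF smooth_f, where v = fst_dir and j = j] sw.zeroV, where v = fst_dir and k = i]
    by (simp add: zero_prod_def)
  also have "\<dots> = jet j i (0, 0)"
    unfolding jet_def by (rule dir_deriv_pow_commute[OF openV smooth_f zeroV])
  finally show ?thesis unfolding partial_jet sw.partial_jet .
qed

section \<open>The chart at a hyperbonode\<close>

locale monge_hyperbonode = monge_chart +
  assumes surface: "smooth_surface S"
    and axes: "{L. asymptotic_line S h L} = {span {e1}, span {e2}}"
    and contact4: "\<And>L. asymptotic_line S h L \<Longrightarrow> contact_at_least S h L 4"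
    and not_contact5: "\<And>L. asymptotic_line S h L \<Longrightarrow> \<not> contact_at_least S h L 5"
begin

lemma jets_axes:
  "jet 2 0 (0, 0) = 0" "jet 3 0 (0, 0) = 0" "jet 0 2 (0, 0) = 0" "jet 0 3 (0, 0) = 0"
  "jet 4 0 (0, 0) \<noteq> 0" "jet 0 4 (0, 0) \<noteq> 0"
proof -
  have a: "asymptotic_line S h (span {e1})" "asymptotic_line S h (span {e2})" using axes by blast+
  have c: "\<forall>j. 2 \<le> j \<and> j < 4 \<longrightarrow> jet j 0 (0, 0) = 0" "\<forall>j. 2 \<le> j \<and> j < 4 \<longrightarrow> jet 0 j (0, 0) = 0"
    "\<not> (\<forall>j. 2 \<le> j \<and> j < 5 \<longrightarrow> jet j 0 (0, 0) = 0)" "\<not> (\<forall>j. 2 \<le> j \<and> j < 5 \<longrightarrow> jet 0 j (0, 0) = 0)"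
    using contact4[OF a(1)] contact4[OF a(2)] not_contact5[OF a(1)] not_contact5[OF a(2)]
    unfolding contact_axis by blast+
  then show "jet 2 0 (0, 0) = 0" "jet 3 0 (0, 0) = 0" "jet 0 2 (0, 0) = 0" "jet 0 3 (0, 0) = 0"
    by simp_all
  have lt: "j < 4 \<or> j = 4" if "j < 5" for j :: nat using that by linarith
  show "jet 4 0 (0, 0) \<noteq> 0" "jet 0 4 (0, 0) \<noteq> 0" using c lt by metis+
qed

text \<open>Both pure second derivatives vanish; without the mixed one every tangent line would be
  asymptotic, for instance that of e1 + e2.\<close>

lemma jet_11_nz: "jet 1 1 (0, 0) \<noteq> 0"
proof
  assume z: "jet 1 1 (0, 0) = 0"
  have nz: "e1 + e2 \<noteq> 0"
  proof
    assume "e1 + e2 = 0"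
    then have "xc (e1 + e2) = 0" using linear_0[OF linear_coords(1)] by simp
    then show False by (simp add: coords_frame)
  qed
  have "xy (e1 + e2) = (1, 1)" by (simp add: xy_frame)
  then have "(dir_deriv (e1 + e2) ^^ 2) eqn h = 0"
    using eqn_dir_deriv_pow[OF hW', of 2 "e1 + e2"] dir_deriv2_f[OF zeroV, of 1 1] jets_axes z xy_h by simp
  moreover have "dir_deriv (e1 + e2) eqn h = 0" by (simp add: eqn_at_h coords_frame)
  ultimately have "asymptotic_line S h (span {e1 + e2})"
    using asymptotic_line_iff[OF hS local_equation_eqn[OF hW'] nz] by (simp add: numeral_2_eq_2)
  then show False using axes span_frame by blast
qed

text \<open>The gradient n of \<open>eqn\<close> at h represents the form \<open>zc\<close>: it is
  orthogonal to e1 and e2 and pairs to 1 with e3. In the Hessian only the mixed derivative survives,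
  so one coordinate of n x e1 or n x e2 is needed, and the triple product computes it.\<close>

lemma twist_axes:
  "twist eqn h e1 = - jet 1 1 (0, 0) * (e1 \<bullet> e1) / frame_det"
  "twist eqn h e2 = jet 1 1 (0, 0) * (e2 \<bullet> e2) / frame_det"
proof -
  define n where "n = grad eqn h"
  have n: "n \<bullet> v = zc v" for v
    using dir_deriv_inner_grad[OF smooth_eqn hW', of v] by (simp add: n_def inner_commute eqn_at_h)
  have "twist eqn h v = - dir_deriv (xy v) (dir_deriv (xy (cross3 n v)) (\<lambda>(x, y). f x y)) (0, 0)" for v
    using eqn_dir_deriv2[OF hW'] xy_h by (simp add: twist_def n_def)
  also have "dir_deriv (xy v) (dir_deriv (xy w) (\<lambda>(x, y). f x y)) (0, 0) = dir_deriv (xy w) (dir_deriv (xy v) (\<lambda>(x, y). f x y)) (0, 0)"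
    for v w by (rule dir_deriv_commute[OF openV smooth_f zeroV])
  finally have t: "twist eqn h v = - dir_deriv (xy (cross3 n v)) (dir_deriv (xy v) (\<lambda>(x, y). f x y)) (0, 0)" for v .
  have j: "dir_deriv fst_dir (\<lambda>(x, y). f x y) = jet 1 0" "dir_deriv snd_dir (\<lambda>(x, y). f x y) = jet 0 1"
    by (simp_all add: jet_def)
  have "twist eqn h e1 = - (yc (cross3 n e1) * jet 1 1 (0, 0))"
    using dir_deriv_jet[OF zeroV, of "xc (cross3 n e1)" "yc (cross3 n e1)" 1 0] jets_axes
    by (simp add: t xy_frame j numeral_2_eq_2) (simp add: xy_def)
  moreover have "yc (cross3 n e1) = (e1 \<bullet> e1) / frame_det"
  proof -
    have "cross3 e3 e1 \<bullet> cross3 n e1 = (n \<bullet> e3) * (e1 \<bullet> e1) - (e3 \<bullet> e1) * (n \<bullet> e1)"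
      by (simp add: cross3_simps)
    then show ?thesis by (simp add: yc_def n coords_frame)
  qed
  ultimately show "twist eqn h e1 = - jet 1 1 (0, 0) * (e1 \<bullet> e1) / frame_det" by simp
  have "twist eqn h e2 = - (xc (cross3 n e2) * jet 1 1 (0, 0))"
    using dir_deriv_jet[OF zeroV, of "xc (cross3 n e2)" "yc (cross3 n e2)" 0 1] jets_axes
    by (simp add: t xy_frame j numeral_2_eq_2) (simp add: xy_def)
  moreover have "xc (cross3 n e2) = - (e2 \<bullet> e2) / frame_det"
  proof -
    have "cross3 e2 e3 \<bullet> cross3 n e2 = (n \<bullet> e2) * (e3 \<bullet> e2) - (e2 \<bullet> e2) * (n \<bullet> e3)"
      by (simp add: cross3_simps)
    then show ?thesis by (simp add: xc_def n coords_frame)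
  qed
  ultimately show "twist eqn h e2 = jet 1 1 (0, 0) * (e2 \<bullet> e2) / frame_det" by simp
qed

lemma twist_axes_opposite: "twist eqn h e1 * twist eqn h e2 < 0"
proof -
  have "twist eqn h e1 * twist eqn h e2 = - ((jet 1 1 (0, 0) / frame_det)\<^sup>2 * ((e1 \<bullet> e1) * (e2 \<bullet> e2)))"
    unfolding twist_axes by (simp add: power2_eq_square)
  moreover have "(jet 1 1 (0, 0) / frame_det)\<^sup>2 * ((e1 \<bullet> e1) * (e2 \<bullet> e2)) > 0"
    using jet_11_nz frame_det_nz e_nz by (intro mult_pos_pos) auto
  ultimately show ?thesis by linarith
qed

lemma handed_axis:
  assumes "handed_asymptotic_line s S h L"
  shows "L = span {e1} \<and> s * twist eqn h e1 < 0 \<or> L = span {e2} \<and> s * twist eqn h e2 < 0"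
proof -
  obtain v where v: "v \<noteq> 0" "L = span {v}" using handed_asymptotic_line_span[OF assms] .
  have "asymptotic_line S h L" using handed_twist(2)[OF surface _ v(1) local_equation_eqn[OF hW']] assms v(2) by blast
  then have "L = span {e1} \<or> L = span {e2}" using axes by blast
  then show ?thesis
    using handed_twist(1)[OF surface _ e_nz(1) local_equation_eqn[OF hW']]
      handed_twist(1)[OF surface _ e_nz(2) local_equation_eqn[OF hW']] assms by blast
qed

lemma handed_axis_unique:
  assumes "handed_asymptotic_line s S h L" "handed_asymptotic_line s S h L'"
  shows "L = L'"
proof -
  have "\<not> (s * twist eqn h e1 < 0 \<and> s * twist eqn h e2 < 0)"
  proof
    assume "s * twist eqn h e1 < 0 \<and> s * twist eqn h e2 < 0"
    then have "0 < (s * twist eqn h e1) * (s * twist eqn h e2)" by (simp only: mult_neg_neg)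
    also have "\<dots> = s\<^sup>2 * (twist eqn h e1 * twist eqn h e2)" by (simp add: power2_eq_square)
    also have "\<dots> \<le> 0"
      using mult_nonneg_nonpos[OF zero_le_power2 less_imp_le[OF twist_axes_opposite]] .
    finally show False by simp
  qed
  then show ?thesis using handed_axis[OF assms(1)] handed_axis[OF assms(2)] by blast
qed

lemma handed_axis_opposite:
  assumes "handed_asymptotic_line s S h L" "handed_asymptotic_line (- s) S h L"
  shows False
  using handed_axis[OF assms(1)] handed_axis[OF assms(2)] span_frame(1) by auto

section \<open>Tangents of the flecnodal curves\<close>

text \<open>Contact of order 1 fixes the normal component of v; orders 2 and 3 give a binary
  quadratic and a binary cubic equation. The vector is left unnormalised because it may still be
  close to either axis.\<close>

lemma flecnodal_direction:
  assumes p: "p \<in> W'" "p \<in> handed_flecnodal_curve s S"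
  defines "z \<equiv> xy p + - xy h"
  obtains v where "v \<noteq> 0" "s * twist eqn p v < 0"
    "zc v = xc v * jet 1 0 z + yc v * jet 0 1 z"
    "(xc v)\<^sup>2 * jet 2 0 z + 2 * xc v * yc v * jet 1 1 z + (yc v)\<^sup>2 * jet 0 2 z = 0"
    "(xc v)^3 * jet 3 0 z + 3 * (xc v)\<^sup>2 * yc v * jet 2 1 z + 3 * xc v * (yc v)\<^sup>2 * jet 1 2 z
      + (yc v)^3 * jet 0 3 z = 0"
proof -
  obtain L where L: "hyperbolic_point S p" "handed_asymptotic_line s S p L" "contact_at_least S p L 4"
    using p(2) unfolding handed_flecnodal_curve_def by blast
  obtain v where v: "v \<noteq> 0" "L = span {v}" using handed_asymptotic_line_span[OF L(2)] .
  have "p \<in> S" using L(1) by (simp add: hyperbolic_point_def)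
  have zV: "z \<in> V" using W'V[OF p(1)] by (simp add: z_def)
  have c: "(dir_deriv v ^^ j) eqn p = 0" if "j < 4" for j
    using contact_at_least_iff[OF \<open>p \<in> S\<close> local_equation_eqn[OF p(1)] v(1)] L(3) v(2) that by blast
  have "s * twist eqn p v < 0"
    using handed_twist(1)[OF surface _ v(1) local_equation_eqn[OF p(1)]] L(2) v(2) by blast
  moreover have "zc v = xc v * jet 1 0 z + yc v * jet 0 1 z"
    using c[of 1] eqn_dir_deriv[OF p(1), of v] dir_deriv_jet[OF zV, of "xc v" "yc v" 0 0]
    by (simp add: jet_00 z_def xy_def)
  moreover have "(dir_deriv (xc v, yc v) ^^ 2) (\<lambda>(x, y). f x y) z = 0"
    using c[of 2] eqn_dir_deriv_pow[OF p(1), of 2 v] by (simp add: z_def xy_def)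
  moreover have "(dir_deriv (xc v, yc v) ^^ 3) (\<lambda>(x, y). f x y) z = 0"
    using c[of 3] eqn_dir_deriv_pow[OF p(1), of 3 v] by (simp add: z_def xy_def)
  ultimately show ?thesis using that[OF v(1)] unfolding dir_deriv2_f[OF zV] dir_deriv3_f[OF zV] by blast
qed

text \<open>The elimination lemma, applied to the second and third derivatives of f along the curve,
  gives one linear relation between the two tangential components of the velocity; the normal one is
  zero. As f11 and f40 do not vanish, this determines the line.\<close>

lemma flecnodal_tangent:
  assumes handed: "handed_asymptotic_line s S h (span {e1})"
    and tangent: "curve_tangent (handed_flecnodal_curve s S) h L"
  shows "L = span {(3 * (partial f 2 1)\<^sup>2 - 2 * partial f 1 1 * partial f 3 1) *\<^sub>R e1
    + (2 * partial f 1 1 * partial f 4 0) *\<^sub>R e2}"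
proof -
  define b where "b = jet 1 1 (0, 0)"
  have b: "b \<noteq> 0" using jet_11_nz by (simp add: b_def)
  obtain N \<epsilon> c \<kappa> where c: "open N" "\<epsilon> > 0" "smooth_on c {-\<epsilon><..<\<epsilon>}"
    "\<And>t. t \<in> {-\<epsilon><..<\<epsilon>} \<Longrightarrow> curve_deriv 1 c t \<noteq> 0"
    "homeomorphism {-\<epsilon><..<\<epsilon>} (handed_flecnodal_curve s S \<inter> N) c \<kappa>"
    "c 0 = h" "L = span {curve_deriv 1 c 0}"
    using tangent unfolding curve_tangent_def by blast
  define c' where "c' = curve_deriv 1 c 0"
  have "c' \<noteq> 0" using c(2,4) by (simp add: c'_def)
  have dc: "(c has_vector_derivative c') (at 0)"
    using smooth_on_curve_deriv(2)[OF _ c(3), of 0 0] c(2) by (simp add: c'_def curve_deriv_def)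
  have "isCont c 0" using dc has_vector_derivative_continuous by blast
  then have ch: "(c \<longlongrightarrow> h) (at 0)" using c(6) by (simp add: isCont_def)
  have evI: "\<forall>\<^sub>F t in at 0. t \<in> {-\<epsilon><..<\<epsilon>}"
    using c(2) by (intro eventually_at_in_open') auto
  have evF: "\<forall>\<^sub>F t in at 0. c t \<in> handed_flecnodal_curve s S"
    using evI c(5) by (auto elim!: eventually_mono simp: homeomorphism_def)
  have evW: "\<forall>\<^sub>F t in at 0. c t \<in> W'" by (rule topological_tendstoD[OF ch openW' hW'])
  define z where "z t = xy (c t) + - xy h" for t
  have z0: "z 0 = (0, 0)" using xy_h by (simp add: z_def c(6))
  have dz: "(z has_vector_derivative (xc c', yc c')) (at 0)"
    using has_vector_derivative_add[OF bounded_linear.has_vector_derivative[OF bounded_linear_coords(4) dc]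
        has_vector_derivative_const[of "- xy h"]]
    unfolding z_def by (simp add: xy_def)
  then have "isCont z 0" using has_vector_derivative_continuous by blast
  then have zlim: "(z \<longlongrightarrow> (0, 0)) (at 0)" using z0 by (simp add: isCont_def)
  have lim: "((\<lambda>t. jet i j (z t)) \<longlongrightarrow> jet i j (0, 0)) (at 0)" for i j
    using isCont_tendsto_compose[OF _ zlim] smooth_on_continuous[OF smooth_jet] openV zeroV
    by (metis continuous_on_eq_continuous_at)
  have dj: "((\<lambda>t. jet i j (z t)) has_real_derivative
      xc c' * jet (Suc i) j (0, 0) + yc c' * jet i (Suc j) (0, 0)) (at 0)" for i j
    using has_real_derivative_along[OF smooth_jet _ dz, of i j] zeroV dir_deriv_jet[OF zeroV] by (simp add: z0)
  have "zc c' = 0"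
  proof -
    have "((\<lambda>t. eqn (c t)) has_real_derivative zc c') (at 0)"
      using has_real_derivative_along[OF smooth_eqn _ dc] hW' by (simp add: c(6) eqn_at_h)
    moreover have "\<forall>\<^sub>F t in nhds 0. eqn (c t) = 0"
    proof -
      have "\<forall>\<^sub>F t in at 0. eqn (c t) = 0"
        using evF evW
      proof eventually_elim
        case (elim t)
        then have "c t \<in> S" by (simp add: handed_flecnodal_curve_def hyperbolic_point_def)
        then show ?case using local_equationD(4)[OF local_equation_eqn] elim by blast
      qed
      then show ?thesis using eqn_at_h(2) c(6) by (simp add: eventually_nhds_conv_at)
    qed
    then have "((\<lambda>t. eqn (c t)) has_real_derivative 0) (at 0)"
      using DERIV_cong_ev[OF refl _ refl, of "\<lambda>t. eqn (c t)" "\<lambda>_. 0" 0 0] by simp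
    ultimately show ?thesis using DERIV_unique by blast
  qed
  have s1: "s * twist eqn h e1 < 0" using handed_twist(1)[OF surface handed e_nz(1) local_equation_eqn[OF hW']] .
  have s2: "s * twist eqn h e2 > 0"
    using s1 twist_axes_opposite by (smt (verit) mult_less_0_iff zero_less_mult_iff)
  \<comment> \<open>Joint continuity at (h, e2) makes the sign wrong for all vectors near e2 at all
    points near h, whether or not these vectors are asymptotic.\<close>
  have "((\<lambda>x. s * twist eqn (fst x) (snd x)) \<longlongrightarrow> s * twist eqn h e2) (nhds h \<times>\<^sub>F nhds e2)"
    by (intro tendsto_mult tendsto_const tendsto_twist[OF openW' smooth_eqn hW'] filterlim_fst filterlim_snd)
  from order_tendstoD(1)[OF this s2] obtain P Q where PQ: "eventually P (nhds h)" "eventually Q (nhds e2)"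
    "\<And>p v. P p \<Longrightarrow> Q v \<Longrightarrow> s * twist eqn p v > 0"
    unfolding eventually_prod_filter by auto
  obtain \<delta> where \<delta>: "\<delta> > 0" "\<And>v. dist v e2 < \<delta> \<Longrightarrow> Q v"
    using PQ(2) unfolding eventually_nhds_metric by blast
  have evP: "\<forall>\<^sub>F t in at 0. P (c t)" using PQ(1) ch unfolding filterlim_iff by blast
  \<comment> \<open>For |n| \<le> 1 this difference bounds |2 f11 + n f20| from below. Its limit is
    2 |b|, so it eventually exceeds |b|.\<close>
  have "((\<lambda>t. \<bar>2 * jet 1 1 (z t)\<bar> - \<bar>jet 2 0 (z t)\<bar>) \<longlongrightarrow> \<bar>2 * jet 1 1 (0, 0)\<bar> - \<bar>jet 2 0 (0, 0)\<bar>) (at 0)"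
    by (intro tendsto_diff tendsto_rabs tendsto_mult tendsto_const lim)
  then have ev1: "\<forall>\<^sub>F t in at 0. \<bar>b\<bar> < \<bar>2 * jet 1 1 (z t)\<bar> - \<bar>jet 2 0 (z t)\<bar>"
    by (rule order_tendstoD(1)) (use b jets_axes in \<open>simp add: b_def\<close>)
  \<comment> \<open>This will bound the distance from e2 of a steep asymptotic vector scaled to
    y-coordinate 1; it tends to 0 because f02 and both first derivatives vanish at h.\<close>
  have "((\<lambda>t. \<bar>jet 0 2 (z t)\<bar> / \<bar>b\<bar> * norm e1 + (\<bar>jet 1 0 (z t)\<bar> + \<bar>jet 0 1 (z t)\<bar>) * norm e3) \<longlongrightarrow>
      \<bar>jet 0 2 (0, 0)\<bar> / \<bar>b\<bar> * norm e1 + (\<bar>jet 1 0 (0, 0)\<bar> + \<bar>jet 0 1 (0, 0)\<bar>) * norm e3) (at 0)"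
    using b by (intro tendsto_add tendsto_rabs tendsto_divide tendsto_mult tendsto_const lim) auto
  then have ev2: "\<forall>\<^sub>F t in at 0. \<bar>jet 0 2 (z t)\<bar> / \<bar>b\<bar> * norm e1 + (\<bar>jet 1 0 (z t)\<bar> + \<bar>jet 0 1 (z t)\<bar>) * norm e3 < \<delta>"
    by (rule order_tendstoD(2)) (use \<delta>(1) jets_axes jet_first in simp)
  have "\<forall>\<^sub>F t in at 0. \<exists>m. \<bar>m\<bar> \<le> 1
      \<and> jet 2 0 (z t) + 2 * jet 1 1 (z t) * m + jet 0 2 (z t) * m\<^sup>2 = 0
      \<and> jet 3 0 (z t) + 3 * jet 2 1 (z t) * m + 3 * jet 1 2 (z t) * m\<^sup>2 + jet 0 3 (z t) * m ^ 3 = 0"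
    using evF evW evP ev1 ev2
  proof eventually_elim
    case (elim t)
    obtain v where v: "v \<noteq> 0" "s * twist eqn (c t) v < 0"
      "zc v = xc v * jet 1 0 (z t) + yc v * jet 0 1 (z t)"
      "(xc v)\<^sup>2 * jet 2 0 (z t) + 2 * xc v * yc v * jet 1 1 (z t) + (yc v)\<^sup>2 * jet 0 2 (z t) = 0"
      "(xc v)^3 * jet 3 0 (z t) + 3 * (xc v)\<^sup>2 * yc v * jet 2 1 (z t)
        + 3 * xc v * (yc v)\<^sup>2 * jet 1 2 (z t) + (yc v)^3 * jet 0 3 (z t) = 0"
      using flecnodal_direction[OF elim(2,1)] unfolding z_def by blast
    show ?case
    proof (cases "\<bar>yc v\<bar> \<le> \<bar>xc v\<bar>")
      case True
      \<comment> \<open>Otherwise the y-coordinate vanishes too, and with it the normal one, a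
        combination of both.\<close>
      have "xc v \<noteq> 0"
      proof
        assume "xc v = 0"
        then have "v = 0" using True v(3) frame_expansion[of v] by simp
        then show False using v(1) by simp
      qed
      define m where "m = yc v / xc v"
      have y: "yc v = m * xc v" using \<open>xc v \<noteq> 0\<close> by (simp add: m_def)
      have "(xc v)\<^sup>2 * (jet 2 0 (z t) + 2 * jet 1 1 (z t) * m + jet 0 2 (z t) * m\<^sup>2) = 0"
        using v(4) unfolding y by (simp add: algebra_simps power2_eq_square)
      moreover have "(xc v)^3 * (jet 3 0 (z t) + 3 * jet 2 1 (z t) * m + 3 * jet 1 2 (z t) * m\<^sup>2
          + jet 0 3 (z t) * m ^ 3) = 0"
        using v(5) unfolding y by (simp add: algebra_simps power2_eq_square power3_eq_cube)
      moreover have "\<bar>m\<bar> \<le> 1" using True \<open>xc v \<noteq> 0\<close> by (simp add: m_def)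
      ultimately show ?thesis using \<open>xc v \<noteq> 0\<close> by (intro exI[of _ m]) simp
    next
      case False
      \<comment> \<open>The quadratic equation makes the inverse slope small, so the direction is
        near e2; this contradicts the sign of the twist.\<close>
      then have "yc v \<noteq> 0" by auto
      define n where "n = xc v / yc v"
      define v' where "v' = (1 / yc v) *\<^sub>R v"
      have x: "xc v = n * yc v" using \<open>yc v \<noteq> 0\<close> by (simp add: n_def)
      have n1: "\<bar>n\<bar> \<le> 1" using False \<open>yc v \<noteq> 0\<close> by (simp add: n_def)
      have "(yc v)\<^sup>2 * (n * (2 * jet 1 1 (z t) + n * jet 2 0 (z t)) + jet 0 2 (z t)) = 0"
        using v(4) unfolding x by (simp add: algebra_simps power2_eq_square)
      then have n2: "n * (2 * jet 1 1 (z t) + n * jet 2 0 (z t)) = - jet 0 2 (z t)"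
        using \<open>yc v \<noteq> 0\<close> by simp
      have "\<bar>n * jet 2 0 (z t)\<bar> \<le> \<bar>jet 2 0 (z t)\<bar>" using n1 by (simp add: abs_mult mult_left_le_one_le)
      then have "\<bar>b\<bar> \<le> \<bar>2 * jet 1 1 (z t) + n * jet 2 0 (z t)\<bar>" using elim(4) by linarith
      then have "\<bar>n\<bar> * \<bar>b\<bar> \<le> \<bar>n * (2 * jet 1 1 (z t) + n * jet 2 0 (z t))\<bar>"
        by (simp add: abs_mult mult_left_mono)
      then have nb: "\<bar>n\<bar> \<le> \<bar>jet 0 2 (z t)\<bar> / \<bar>b\<bar>"
        unfolding n2 using b by (simp add: pos_le_divide_eq)
      define d where "d = n * jet 1 0 (z t) + jet 0 1 (z t)"
      have "\<bar>n * jet 1 0 (z t)\<bar> \<le> \<bar>jet 1 0 (z t)\<bar>" using n1 by (simp add: abs_mult mult_left_le_one_le)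
      then have db: "\<bar>d\<bar> \<le> \<bar>jet 1 0 (z t)\<bar> + \<bar>jet 0 1 (z t)\<bar>" unfolding d_def by linarith
      have "zc v = d * yc v" unfolding v(3) x d_def by (simp add: algebra_simps)
      have "v' = (1 / yc v) *\<^sub>R (xc v *\<^sub>R e1 + yc v *\<^sub>R e2 + zc v *\<^sub>R e3)"
        unfolding v'_def by (rule arg_cong[OF frame_expansion])
      also have "\<dots> = n *\<^sub>R e1 + e2 + d *\<^sub>R e3"
        using \<open>yc v \<noteq> 0\<close> by (simp add: scaleR_add_right x \<open>zc v = d * yc v\<close>)
      finally have "v' = n *\<^sub>R e1 + e2 + d *\<^sub>R e3" .
      then have "dist v' e2 = norm (n *\<^sub>R e1 + d *\<^sub>R e3)" by (simp add: dist_norm)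
      also have "\<dots> \<le> \<bar>n\<bar> * norm e1 + \<bar>d\<bar> * norm e3"
        by (rule order_trans[OF norm_triangle_ineq]) simp
      also have "\<dots> \<le> \<bar>jet 0 2 (z t)\<bar> / \<bar>b\<bar> * norm e1 + (\<bar>jet 1 0 (z t)\<bar> + \<bar>jet 0 1 (z t)\<bar>) * norm e3"
        using nb db by (intro add_mono mult_right_mono) auto
      also have "\<dots> < \<delta>" by (rule elim(5))
      finally have "s * twist eqn (c t) v' > 0" using PQ(3)[OF elim(3)] \<delta>(2) by blast
      then have "(1 / yc v)\<^sup>2 * (s * twist eqn (c t) v) > 0"
        unfolding v'_def twist_scale[OF openW' smooth_eqn elim(2)] by (simp only: mult.left_commute)
      moreover have "(1 / yc v)\<^sup>2 * (s * twist eqn (c t) v) \<le> 0"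
        using mult_nonneg_nonpos[OF zero_le_power2 less_imp_le[OF v(2)]] .
      ultimately have False by linarith
      then show ?thesis ..
    qed
  qed
  \<comment> \<open>As f30 = 0 at h, the derivative of f20 along the curve is the y-velocity times
    f21; that of f30 involves f40 and f31.\<close>
  from common_root_derivative[OF this dj _ lim[of 1 1] jet_11_nz _ dj _ lim lim lim]
  have "2 * jet 1 1 (0, 0) * (xc c' * jet 4 0 (0, 0) + yc c' * jet 3 1 (0, 0))
      = 3 * jet 2 1 (0, 0) * (yc c' * jet 2 1 (0, 0))"
    using jets_axes lim[of 0 2] z0 by (simp add: eval_nat_numeral)
  then have *: "xc c' * (2 * jet 1 1 (0, 0) * jet 4 0 (0, 0))
      = yc c' * (3 * (jet 2 1 (0, 0))\<^sup>2 - 2 * jet 1 1 (0, 0) * jet 3 1 (0, 0))"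
    by (simp add: algebra_simps power2_eq_square)
  define A where "A = 2 * jet 1 1 (0, 0) * jet 4 0 (0, 0)"
  define B where "B = 3 * (jet 2 1 (0, 0))\<^sup>2 - 2 * jet 1 1 (0, 0) * jet 3 1 (0, 0)"
  have "A \<noteq> 0" using jet_11_nz jets_axes by (simp add: A_def)
  then have xc: "xc c' = (yc c' / A) * B" using * by (simp add: A_def B_def field_simps)
  have yc: "yc c' = (yc c' / A) * A" using \<open>A \<noteq> 0\<close> by simp
  have "c' = (yc c' / A) *\<^sub>R (B *\<^sub>R e1 + A *\<^sub>R e2)"
    using frame_expansion[of c'] \<open>zc c' = 0\<close> xc yc by (simp add: scaleR_add_right)
  moreover have "yc c' / A \<noteq> 0" using calculation \<open>c' \<noteq> 0\<close> by auto
  ultimately have "span {c'} = span {B *\<^sub>R e1 + A *\<^sub>R e2}" using span_singleton_scale by metis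
  then show ?thesis using c(7) by (simp add: c'_def partial_jet A_def B_def)
qed

section \<open>Parity\<close>

lemma leading_axis:
  "((\<lambda>t. eqn (h + t *\<^sub>R e1) / t ^ 4) \<longlongrightarrow> - jet 4 0 (0, 0) / fact 4) (at 0)"
  "((\<lambda>t. eqn (h + t *\<^sub>R e2) / t ^ 4) \<longlongrightarrow> - jet 0 4 (0, 0) / fact 4) (at 0)"
  and axis_vanish: "j < 4 \<Longrightarrow> (dir_deriv e1 ^^ j) eqn h = 0" "j < 4 \<Longrightarrow> (dir_deriv e2 ^^ j) eqn h = 0"
proof -
  have a: "asymptotic_line S h (span {e1})" "asymptotic_line S h (span {e2})" using axes by blast+
  show v: "(dir_deriv e1 ^^ j) eqn h = 0" "(dir_deriv e2 ^^ j) eqn h = 0" if "j < 4" for j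
    using contact4[OF a(1)] contact4[OF a(2)] that
    unfolding contact_at_least_iff[OF hS local_equation_eqn[OF hW'] e_nz(1)]
      contact_at_least_iff[OF hS local_equation_eqn[OF hW'] e_nz(2)] by blast+
  show "((\<lambda>t. eqn (h + t *\<^sub>R e1) / t ^ 4) \<longlongrightarrow> - jet 4 0 (0, 0) / fact 4) (at 0)"
    using leading_coefficient_line[OF openW' smooth_eqn hW' v(1), of 4] eqn_at_h(3)[of 4] by simp
  show "((\<lambda>t. eqn (h + t *\<^sub>R e2) / t ^ 4) \<longlongrightarrow> - jet 0 4 (0, 0) / fact 4) (at 0)"
    using leading_coefficient_line[OF openW' smooth_eqn hW' v(2), of 4] eqn_at_h(4)[of 4] by simp
qed

text \<open>The sides are measured by an arbitrary equation with limit ratio k to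
  \<open>eqn\<close>. Positivity along the axes makes both k f40 and k f04 negative with the same k,
  so the sign of k cancels in the product.\<close>

lemma same_side_iff:
  "same_side S h (span {e1}) (span {e2}) \<longleftrightarrow> jet 4 0 (0, 0) * jet 0 4 (0, 0) > 0"
proof
  assume "same_side S h (span {e1}) (span {e2})"
  then obtain v w N g \<epsilon> where g: "span {e1} = span {v}" "span {e2} = span {w}" "local_equation S h N g"
    "\<epsilon> > 0" "\<And>t. 0 < \<bar>t\<bar> \<Longrightarrow> \<bar>t\<bar> < \<epsilon> \<Longrightarrow> g (h + t *\<^sub>R v) > 0 \<and> g (h + t *\<^sub>R w) > 0"
    unfolding same_side_def by blast
  note L = local_equationD[OF g(3)]
  obtain k where k: "ratio_at h k eqn g" "k \<noteq> 0"
    using local_equation_ratio[OF hS local_equation_eqn[OF hW'] g(3)] by blast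
  have neg: "k * jt < 0"
    if sp: "span {e} = span {u}" "e \<noteq> 0" and vanish: "\<And>j. j < 4 \<Longrightarrow> (dir_deriv e ^^ j) eqn h = 0"
      and jt: "(dir_deriv e ^^ 4) eqn h = - jt" "jt \<noteq> 0" and pos: "\<And>t. 0 < \<bar>t\<bar> \<Longrightarrow> \<bar>t\<bar> < \<epsilon> \<Longrightarrow> g (h + t *\<^sub>R u) > 0" for e u jt
  proof -
    have r: "(dir_deriv e ^^ j) g h = k * (dir_deriv e ^^ j) eqn h" if "j \<le> 4" for j
      using that vanish
      by (intro ratio_at_dir_deriv_pow[OF k(1) openW' smooth_eqn hW' L(1,3,2)]) auto
    \<comment> \<open>The given generator may be a negative multiple of the axis vector; the fourth
      power of the factor is positive anyway.\<close>
    obtain a where a: "a \<noteq> 0" "e = a *\<^sub>R u" using span_singleton_eqD[OF sp] .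
    have u: "a ^ j * (dir_deriv u ^^ j) g h = k * (dir_deriv e ^^ j) eqn h" if "j \<le> 4" for j
      using r[OF that] dir_deriv_pow_scale[OF L(1,3,2)] a(2) by metis
    have z: "(dir_deriv u ^^ j) g h = 0" if "j < 4" for j
      using u[of j] that a(1) vanish by simp
    have "\<forall>\<^sub>F t in at 0. 0 \<le> g (h + t *\<^sub>R u) / t ^ 4"
      using g(4) pos by (auto simp: eventually_at dist_real_def less_imp_le intro!: exI[of _ \<epsilon>])
    then have "(dir_deriv u ^^ 4) g h / fact 4 \<ge> 0"
      using tendsto_lowerbound[OF leading_coefficient_line[OF L(1,3,2) z]] by simp
    then have "(dir_deriv u ^^ 4) g h \<ge> 0" by (smt (verit) divide_neg_pos fact_gt_zero)
    then have "a ^ 4 * (dir_deriv u ^^ 4) g h \<ge> 0" by simp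
    then have "k * (- jt) \<ge> 0" using u[of 4] jt(1) by simp
    \<comment> \<open>The limit gives a weak inequality only; it is strict because k and the fourth
      derivative are nonzero.\<close>
    then show ?thesis using k(2) jt(2) by (smt (verit) mult_eq_0_iff mult_minus_right)
  qed
  have "k * jet 4 0 (0, 0) < 0"
    by (rule neg[OF g(1) e_nz(1) axis_vanish(1) eqn_at_h(3)]) (use jets_axes g(5) in auto)
  moreover have "k * jet 0 4 (0, 0) < 0"
    by (rule neg[OF g(2) e_nz(2) axis_vanish(2) eqn_at_h(4)]) (use jets_axes g(5) in auto)
  ultimately show "jet 4 0 (0, 0) * jet 0 4 (0, 0) > 0"
    by (smt (verit) mult_less_0_iff zero_less_mult_iff)
next
  assume pos: "jet 4 0 (0, 0) * jet 0 4 (0, 0) > 0"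
  have evW: "\<forall>\<^sub>F t in at 0. h + t *\<^sub>R v \<in> W'" for v
    by (rule topological_tendstoD[OF tendsto_line openW' hW'])
  have conclude: "same_side S h (span {e1}) (span {e2})" if "local_equation S h W' g"
    "\<forall>\<^sub>F t in at 0. g (h + t *\<^sub>R e1) > 0" "\<forall>\<^sub>F t in at 0. g (h + t *\<^sub>R e2) > 0" for g
  proof -
    have "\<forall>\<^sub>F t in at 0. h + t *\<^sub>R e1 \<in> W' \<and> h + t *\<^sub>R e2 \<in> W' \<and> g (h + t *\<^sub>R e1) > 0 \<and> g (h + t *\<^sub>R e2) > 0"
      using evW that(2,3) by (intro eventually_conj)
    then obtain \<epsilon> where "\<epsilon> > 0" "\<And>t. t \<noteq> 0 \<Longrightarrow> \<bar>t\<bar> < \<epsilon> \<Longrightarrow> h + t *\<^sub>R e1 \<in> W' \<and> h + t *\<^sub>R e2 \<in> W'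
        \<and> g (h + t *\<^sub>R e1) > 0 \<and> g (h + t *\<^sub>R e2) > 0"
      unfolding eventually_at by (auto simp: dist_real_def)
    then show "same_side S h (span {e1}) (span {e2})" unfolding same_side_def
      using that(1) by (intro exI[of _ e1] exI[of _ e2] exI[of _ W'] exI[of _ g] exI[of _ \<epsilon>]) auto
  qed
  have pos4: "\<forall>\<^sub>F t in at 0. \<phi> t > 0" if "\<forall>\<^sub>F t in at 0. \<phi> t / t ^ 4 > 0" for \<phi> :: "real \<Rightarrow> real"
    using that by eventually_elim (auto simp: zero_less_divide_iff)
  have neg4: "\<forall>\<^sub>F t in at 0. - \<phi> t > 0" if "\<forall>\<^sub>F t in at 0. \<phi> t / t ^ 4 < 0" for \<phi> :: "real \<Rightarrow> real"
    using that by eventually_elim (auto simp: divide_less_0_iff)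
  \<comment> \<open>On the axes \<open>eqn\<close> equals - f, so it is positive there for negative
    quartic coefficients; for positive ones its negative is used.\<close>
  show "same_side S h (span {e1}) (span {e2})"
  proof (cases "jet 4 0 (0, 0) < 0")
    case True
    then have "jet 0 4 (0, 0) < 0" using pos by (simp add: zero_less_mult_iff)
    have "\<forall>\<^sub>F t in at 0. eqn (h + t *\<^sub>R e1) / t ^ 4 > 0"
      by (rule order_tendstoD(1)[OF leading_axis(1)]) (use True in \<open>simp add: divide_neg_pos\<close>)
    moreover have "\<forall>\<^sub>F t in at 0. eqn (h + t *\<^sub>R e2) / t ^ 4 > 0"
      by (rule order_tendstoD(1)[OF leading_axis(2)]) (use \<open>jet 0 4 (0, 0) < 0\<close> in \<open>simp add: divide_neg_pos\<close>)
    ultimately show ?thesis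
      by (rule conclude[OF local_equation_eqn[OF hW'] pos4 pos4])
  next
    case False
    then have p: "jet 4 0 (0, 0) > 0" "jet 0 4 (0, 0) > 0" using pos by (auto simp: zero_less_mult_iff)
    have "\<forall>\<^sub>F t in at 0. eqn (h + t *\<^sub>R e1) / t ^ 4 < 0"
      by (rule order_tendstoD(2)[OF leading_axis(1)]) (use p in simp)
    moreover have "\<forall>\<^sub>F t in at 0. eqn (h + t *\<^sub>R e2) / t ^ 4 < 0"
      by (rule order_tendstoD(2)[OF leading_axis(2)]) (use p in simp)
    ultimately show ?thesis
      by (rule conclude[OF local_equation_uminus[OF local_equation_eqn[OF hW']] neg4 neg4])
  qed
qed

end

lemma monge_hyperbonode_swap:
  assumes "monge_hyperbonode S h e1 e2 e3 f W V"
  shows "monge_hyperbonode S h e2 e1 e3 (\<lambda>x y. f y x) W (prod.swap -` V)"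
proof -
  interpret monge_hyperbonode S h e1 e2 e3 f W V by fact
  interpret sw: monge_chart S h e2 e1 e3 "\<lambda>x y. f y x" W "prod.swap -` V"
    by (rule monge_chart_swap[OF monge_chart_axioms])
  show ?thesis
    by unfold_locales (use surface axes contact4 not_contact5 in auto)
qed

section \<open>Cross-ratio and index\<close>

context monge_hyperbonode
begin

lemma index_formula:
  assumes left: "handed_asymptotic_line (- \<omega>) S h (span {e1})"
    and right: "handed_asymptotic_line \<omega> S h (span {e2})"
    and generic: "generic_hyperbonode \<omega> S h"
  shows "hyperbonode_index \<omega> S h =
    sgn (4 * (partial f 1 1)\<^sup>2 * partial f 4 0 * partial f 0 4
      - (3 * (partial f 2 1)\<^sup>2 - 2 * partial f 1 1 * partial f 3 1)
        * (3 * (partial f 1 2)\<^sup>2 - 2 * partial f 1 1 * partial f 1 3))"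
proof -
  interpret sw: monge_hyperbonode S h e2 e1 e3 "\<lambda>x y. f y x" W "prod.swap -` V"
    by (rule monge_hyperbonode_swap[OF monge_hyperbonode_axioms])
  note swap = partial_swap[OF monge_chart_axioms]
  define A B P Q where "A = 2 * partial f 1 1 * partial f 4 0" "B = 2 * partial f 1 1 * partial f 0 4"
    "P = 3 * (partial f 2 1)\<^sup>2 - 2 * partial f 1 1 * partial f 3 1"
    "Q = 3 * (partial f 1 2)\<^sup>2 - 2 * partial f 1 1 * partial f 1 3"
  note defs = this
  have lines: "left_asymptotic_line \<omega> S h = span {e1}" "right_asymptotic_line \<omega> S h = span {e2}"
    unfolding left_asymptotic_line_def right_asymptotic_line_def
    using left right handed_axis_unique by (auto intro!: the_equality)
  have tl: "L = span {P *\<^sub>R e1 + A *\<^sub>R e2}" if "curve_tangent (left_flecnodal_curve \<omega> S) h L" for L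
    using flecnodal_tangent[OF left] that by (simp add: left_flecnodal_curve_def defs)
  have tr: "L = span {Q *\<^sub>R e2 + B *\<^sub>R e1}" if "curve_tangent (right_flecnodal_curve \<omega> S) h L" for L
    using sw.flecnodal_tangent[OF right] that by (simp add: right_flecnodal_curve_def defs swap)
  \<comment> \<open>Existence of the tangents comes from genericity, uniqueness from the explicit
    spans.\<close>
  have tangents: "tangent_line (left_flecnodal_curve \<omega> S) h = span {P *\<^sub>R e1 + A *\<^sub>R e2}"
    "tangent_line (right_flecnodal_curve \<omega> S) h = span {Q *\<^sub>R e2 + B *\<^sub>R e1}"
    using generic tl tr unfolding generic_hyperbonode_def smooth_curve_at_def tangent_line_def
    by (metis the_equality)+
  have AB: "A * B = (2 * partial f 1 1)\<^sup>2 * (partial f 4 0 * partial f 0 4)"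
    by (simp add: defs power2_eq_square)
  have nz: "A * B \<noteq> 0" using jet_11_nz jets_axes unfolding AB partial_jet by simp
  have cr: "r = (A * B - P * Q) / (A * B)" if "has_cr_invariant \<omega> S h r" for r
  proof -
    \<comment> \<open>In coordinates xc, yc the determinants are D u1 u4 = - A, D u2 u3 = - B, D u1
      u3 = P Q - A B and D u2 u4 = - 1.\<close>
    have "r * (A * B) = A * B - P * Q"
      using cross_ratio_determinants[OF linear_coords(1,2) that[unfolded has_cr_invariant_def lines tangents]]
      by (simp add: coords_frame algebra_simps)
    then show ?thesis using nz by (simp add: nonzero_eq_divide_eq)
  qed
  obtain r where r: "has_cr_invariant \<omega> S h r" using generic unfolding generic_hyperbonode_def by blast
  then have "cr_invariant \<omega> S h = (A * B - P * Q) / (A * B)"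
    unfolding cr_invariant_def using cr by (metis the_equality)
  then have "hyperbonode_index \<omega> S h =
      (if partial f 4 0 * partial f 0 4 > 0 then 1 else - 1) * (sgn (A * B - P * Q) / sgn (A * B))"
    unfolding hyperbonode_index_def hyperbonode_parity_def lines same_side_iff partial_jet
    by (simp add: sgn_divide)
  \<comment> \<open>A B is f40 f04 times a positive square, so the parity cancels the sign of the
    denominator of the cross-ratio.\<close>
  also have "(if partial f 4 0 * partial f 0 4 > 0 then 1 else - 1) = sgn (A * B)"
  proof -
    define X where "X = partial f 4 0 * partial f 0 4"
    have "X \<noteq> 0" "(2 * partial f 1 1)\<^sup>2 > 0" using nz unfolding AB X_def by auto
    then have "sgn ((2 * partial f 1 1)\<^sup>2 * X) = sgn X" by (simp only: sgn_mult sgn_pos mult_1)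
    then show ?thesis using \<open>X \<noteq> 0\<close> unfolding AB X_def[symmetric] by (simp only: sgn_if) simp
  qed
  also have "sgn (A * B) * (sgn (A * B - P * Q) / sgn (A * B)) = sgn (A * B - P * Q)"
    using nz by (simp add: sgn_zero_iff)
  finally show ?thesis by (simp add: defs power2_eq_square mult_ac)
qed

end

theorem theorem5:
  fixes S :: "(real^3) set" and h e1 e2 e3 :: "real^3"
    and f :: "real \<Rightarrow> real \<Rightarrow> real" and \<omega> :: real
  assumes orientation: "\<omega> = 1 \<or> \<omega> = -1"
    and surface: "smooth_surface S"
    and generic: "generic_hyperbonode \<omega> S h"
    and monge: "monge_form S h e1 e2 e3 f"
    and axes: "{L. asymptotic_line S h L} = {span {e1}, span {e2}}"
  shows "hyperbonode_index \<omega> S h =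
    sgn (4 * (partial f 1 1)\<^sup>2 * partial f 4 0 * partial f 0 4
      - (3 * (partial f 2 1)\<^sup>2 - 2 * partial f 1 1 * partial f 3 1)
        * (3 * (partial f 1 2)\<^sup>2 - 2 * partial f 1 1 * partial f 1 3))"
proof -
  obtain W V where chart: "monge_chart S h e1 e2 e3 f W V"
    using monge unfolding monge_form_def monge_chart_def by blast
  interpret monge_hyperbonode S h e1 e2 e3 f W V
    using chart surface axes generic
    unfolding monge_hyperbonode_def monge_hyperbonode_axioms_def generic_hyperbonode_def by blast
  obtain Ll Lr where L: "handed_asymptotic_line (- \<omega>) S h Ll" "handed_asymptotic_line \<omega> S h Lr"
    using generic unfolding generic_hyperbonode_def hyperbonode_def left_flecnodal_curve_def
      right_flecnodal_curve_def handed_flecnodal_curve_def by blast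
  \<comment> \<open>A line cannot carry both labels, so the labelled lines are the two axes in one
    of the two orders.\<close>
  have "Ll \<noteq> Lr" using handed_axis_opposite[OF L(2)] L(1) by blast
  then consider "Ll = span {e1}" "Lr = span {e2}" | "Ll = span {e2}" "Lr = span {e1}"
    using handed_axis[OF L(1)] handed_axis[OF L(2)] by blast
  then show ?thesis
  proof cases
    case 1
    then show ?thesis using index_formula L generic by blast
  next
    case 2
    interpret sw: monge_hyperbonode S h e2 e1 e3 "\<lambda>x y. f y x" W "prod.swap -` V"
      by (rule monge_hyperbonode_swap[OF monge_hyperbonode_axioms])
    show ?thesis
      \<comment> \<open>The formula is symmetric under exchange of the variables, so the swapped
        chart gives the same expression.\<close>
      using sw.index_formula[of \<omega>] L 2 generic
      unfolding partial_swap[OF monge_chart_axioms] by (simp add: mult_ac)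
  qed
qed

end
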